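(* Let $\pi_{L,N}$ be the canonical stationary measures with weights $w_L$ satisfying the standing assumptions in the context. Let $\rho\ge 0$ and consider the thermodynamic limit $L,N=N_L\to\infty$ with $N/L\to\rho$. Then for any fixed finite set of sites $\Delta$ (contained in $\Lambda=\Lambda_L$ for all $L$ large enough), denoting by $\pi_{L,N}^\Delta$ the marginal of $\pi_{L,N}$ on $\mathbb{N}_0^\Delta$, we have $$\pi_{L,N}^\Delta \overset{d}{\longrightarrow} \nu_{\Phi(\rho)}^\Delta ,\qquad\text{where}\quad \Phi(\rho)=\begin{cases}\phi & \text{with } \phi \text{ such that } R(\phi)=\rho,\ \text{ if } \rho\le\rho_c,\\ 1 & \text{if } \rho>\rho_c .\end{cases}$$
   Context: Setting. For each $L$, $\Lambda=\Lambda_L$ is a finite index set with $|\Lambda|=L$; configurations are $\eta=(\eta_x)_{x\in\Lambda}\in\mathbb{N}_0^\Lambda$, and $E_{L,N}=\{\eta\in\mathbb{N}_0^\Lambda:\sum_{x\in\Lambda}\eta_x=N\}$. The canonical measure on $E_{L,N}$ is $$\pi_{L,N}[\eta]=\frac{1}{Z_{L,N}}\prod_{x\in\Lambda}w_L(\eta_x),\qquad Z_{L,N}=\sum_{\eta\in E_{L,N}}\prod_{x\in\Lambda}w_L(\eta_x).$$ Standing assumptions on the weights. The $w_L$ are strictly positive and of the form $$w_L(n)=w(n)+\frac{\theta}{L^\gamma}(n+1)^\kappa\big(1+\delta_L(n)\big),\qquad n\in\mathbb{N}_0,$$ with constants $\theta>0$, $\gamma>0$, $\kappa>-1$, where $L\sup_{n\le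 N}|\delta_L(n)|\to0$ in the thermodynamic limit. The bulk weights $w:\mathbb{N}_0\to[0,\infty)$ satisfy: there is $\bar\phi\in(1,\infty]$ such that $z(\phi):=\sum_{n\ge0}w(n)\phi^n<\infty$ (for $\phi\ge 0$) if and only if $\phi\in[0,\bar\phi)$; $\sum_{n\ge0}w(n)=1$; and $\rho_c:=\sum_{n\ge0}n\,w(n)<\infty$. Put $R(\phi):=\frac{1}{z(\phi)}\sum_{n\ge0}n\,w(n)\phi^n$; it is continuous and increasing with $R(0)=0$, $R(1)=\rho_c$, and for every $\rho\ge0$ there is $\phi\in[0,\bar\phi)$ with $R(\phi)=\rho$. For $\phi\in[0,\bar\phi)$, $\nu_\phi^\Delta$ denotes the product probability measure on $\mathbb{N}_0^\Delta$ whose single-site marginals are $\nu_\phi(n)=w(n)\phi^n/z(\phi)$, $n\in\mathbb{N}_0$ (so $\nu_1(n)=w(n)$). *)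

theory Defs
  imports "HOL-Probability.Probability"
begin

section \<open>Canonical measures\<close>

text \<open>Configurations on a site set \<open>S\<close> are extensional functions, so that
  \<open>\<nat>\<^sub>0\<^sup>S\<close> is \<open>S \<rightarrow>\<^sub>E UNIV\<close>, the carrier both of
  \<^const>\<open>PiM\<close> and of \<^const>\<open>product_topology\<close>.\<close>

definition configs :: "'a set \<Rightarrow> nat \<Rightarrow> ('a \<Rightarrow> nat) set" where
  "configs S N = {\<eta> \<in> S \<rightarrow>\<^sub>E UNIV. (\<Sum>x\<in>S. \<eta> x) = N}"

definition partition_fun :: "(nat \<Rightarrow> real) \<Rightarrow> 'a set \<Rightarrow> nat \<Rightarrow> real" where
  "partition_fun v S N = (\<Sum>\<eta>\<in>configs S N. \<Prod>x\<in>S. v (\<eta> x))"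

definition canonical_measure :: "(nat \<Rightarrow> real) \<Rightarrow> 'a set \<Rightarrow> nat \<Rightarrow> ('a \<Rightarrow> nat) measure" where
  "canonical_measure v S N =
     point_measure (configs S N) (\<lambda>\<eta>. ennreal ((\<Prod>x\<in>S. v (\<eta> x)) / partition_fun v S N))"

definition marginal :: "'a set \<Rightarrow> ('a \<Rightarrow> nat) measure \<Rightarrow> ('a \<Rightarrow> nat) measure" where
  "marginal D M = distr M (PiM D (\<lambda>_. count_space UNIV)) (\<lambda>\<eta>. restrict \<eta> D)"

definition perturbed_weight ::
    "(nat \<Rightarrow> real) \<Rightarrow> real \<Rightarrow> real \<Rightarrow> real \<Rightarrow> (nat \<Rightarrow> nat \<Rightarrow> real) \<Rightarrow> nat \<Rightarrow> nat \<Rightarrow> real" where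
  "perturbed_weight w \<theta> \<gamma> \<kappa> \<delta> L n =
     w n + \<theta> / real L powr \<gamma> * (real n + 1) powr \<kappa> * (1 + \<delta> L n)"

section \<open>Grand-canonical bulk measures\<close>

definition bulk_z :: "(nat \<Rightarrow> real) \<Rightarrow> real \<Rightarrow> real" where
  "bulk_z w \<phi> = (\<Sum>n. w n * \<phi> ^ n)"

definition bulk_R :: "(nat \<Rightarrow> real) \<Rightarrow> real \<Rightarrow> real" where
  "bulk_R w \<phi> = 1 / bulk_z w \<phi> * (\<Sum>n. real n * w n * \<phi> ^ n)"

definition crit_density :: "(nat \<Rightarrow> real) \<Rightarrow> real" where
  "crit_density w = (\<Sum>n. real n * w n)"

text \<open>If \<open>bulk_R w\<close> maps \<open>[0, \<phi>bar)\<close> onto \<open>[0, \<infinity>)\<close>, then \<open>w\<close> is not concentrated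
  on one point, \<open>bulk_R w\<close> is strictly increasing there, and the choice below is unique.\<close>

definition bulk_Phi :: "(nat \<Rightarrow> real) \<Rightarrow> ereal \<Rightarrow> real \<Rightarrow> real" where
  "bulk_Phi w \<phi>bar \<rho> =
     (if \<rho> \<le> crit_density w
      then SOME \<phi>. 0 \<le> \<phi> \<and> ereal \<phi> < \<phi>bar \<and> bulk_R w \<phi> = \<rho>
      else 1)"

definition bulk_site :: "(nat \<Rightarrow> real) \<Rightarrow> real \<Rightarrow> nat measure" where
  "bulk_site w \<phi> = point_measure UNIV (\<lambda>n. ennreal (w n * \<phi> ^ n / bulk_z w \<phi>))"

definition bulk_measure :: "(nat \<Rightarrow> real) \<Rightarrow> real \<Rightarrow> 'a set \<Rightarrow> ('a \<Rightarrow> nat) measure" where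
  "bulk_measure w \<phi> D = PiM D (\<lambda>_. bulk_site w \<phi>)"

section \<open>Convergence in distribution\<close>

text \<open>\<^const>\<open>weak_conv_m\<close> covers measures on the real line only. Here the
  state space is a topology, and the test functions are the bounded continuous ones.\<close>

definition converges_in_distribution ::
    "'b topology \<Rightarrow> (nat \<Rightarrow> 'b measure) \<Rightarrow> 'b measure \<Rightarrow> bool" where
  "converges_in_distribution X M M' \<longleftrightarrow>
     (\<forall>f. continuous_map X euclideanreal f \<and> bounded (f ` topspace X) \<longrightarrow>
        (\<lambda>n. \<integral>x. f x \<partial>M n) \<longlonglongrightarrow> (\<integral>x. f x \<partial>M'))"

definition config_topology :: "'a set \<Rightarrow> ('a \<Rightarrow> nat) topology" where
  "config_topology D = product_topology (\<lambda>_. discrete_topology UNIV) D"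

end

theory Submission
  imports Defs "HOL-Real_Asymp.Real_Asymp"
begin

text \<open>Let \<open>A\<close> be the \<open>M\<close>-th coefficient of the \<open>m\<close>-th convolution power of the weights.
  Multiplying the weight of the value \<open>k\<close> by \<open>x > 0\<close> multiplies \<open>A\<close> by the canonical
  expectation of \<open>x\<close> to the number of sites with value \<open>k\<close>, which by Jensen is at least
  \<open>x powr (m q)\<close>, where \<open>q\<close> is the canonical probability that a given site has value \<open>k\<close>. The
  generating function bounds the tilted coefficient from above. Hence, if
  \<open>ln A / m\<close> has the grand-canonical rate \<open>ln z(\<Phi>) - \<rho> ln \<Phi>\<close>, then in the limit
  \<open>q ln x \<le> (x - 1) p\<close> with \<open>p\<close> the bulk probability of \<open>k\<close>, and \<open>x \<rightarrow> 1\<close> from both sides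
  gives \<open>q \<rightarrow> p\<close>. Several sites are handled by peeling them off one at a time.

  The rate is bounded from below by letting one site carry all excess particles, at subexponential
  cost because of the perturbation, so that only the event that the other sites hold at most \<open>M\<close>
  particles has to be estimated; this is a Chernoff bound for the bulk weights.\<close>

section \<open>Convolution powers and tilting\<close>

text \<open>This is the partition function of \<open>m\<close> sites with \<open>M\<close> particles
  (\<open>partition_fun_eq_conv_pow\<close>). It depends on the sites only through their number, so
  all estimates can be done by induction on \<open>m\<close>, without configurations.\<close>

primrec conv_pow :: "(nat \<Rightarrow> real) \<Rightarrow> nat \<Rightarrow> nat \<Rightarrow> real" where
  "conv_pow v 0 M = (if M = 0 then 1 else 0)"
| "conv_pow v (Suc m) M = (\<Sum>j\<le>M. v j * conv_pow v m (M - j))"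

lemma conv_pow_nonneg: "(\<And>j. j \<le> M \<Longrightarrow> 0 \<le> v j) \<Longrightarrow> 0 \<le> conv_pow v m M"
  by (induction m arbitrary: M) (auto intro!: sum_nonneg)

lemma conv_pow_at_0: "conv_pow v m 0 = v 0 ^ m"
  by (induction m) auto

lemma conv_pow_mono:
  assumes "\<And>j. j \<le> M \<Longrightarrow> 0 \<le> u j" "\<And>j. j \<le> M \<Longrightarrow> u j \<le> v j"
  shows "conv_pow u m M \<le> conv_pow v m M"
  using assms
proof (induction m arbitrary: M)
  case (Suc m)
  have "u j * conv_pow u m (M - j) \<le> v j * conv_pow v m (M - j)" if "j \<le> M" for j
  proof (rule mult_mono)
    show "0 \<le> v j" using Suc.prems[OF that] by linarith
  qed (use Suc that in \<open>auto intro!: conv_pow_nonneg\<close>)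
  then show ?case by (auto intro: sum_mono)
qed auto

lemma conv_pow_pos:
  assumes "\<And>j. 0 < v j" "0 < m"
  shows "0 < conv_pow v m M"
  using assms(2)
proof (induction m arbitrary: M)
  case (Suc m)
  show ?case
  proof (cases m)
    case 0
    have "0 < v M * conv_pow v m (M - M)" using 0 assms(1) by simp
    also have "\<dots> \<le> (\<Sum>j\<le>M. v j * conv_pow v m (M - j))"
      by (rule member_le_sum) (auto intro!: mult_nonneg_nonneg conv_pow_nonneg less_imp_le[OF assms(1)])
    finally show ?thesis by simp
  next
    case (Suc m')
    then have "0 < v j * conv_pow v m (M - j)" for j using Suc.IH[of "M - j"] assms(1) by simp
    then show ?thesis by (auto intro!: sum_pos simp del: conv_pow.simps(2) simp: conv_pow.simps(2)[of v m])
  qed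
qed auto

text \<open>The coefficient of order \<open>M\<close> only sees weights up to \<open>M\<close>.
  Truncating the generating function matters because the perturbed weights are controlled only up to
  \<open>N L\<close>, and their full series need not converge.\<close>

lemma conv_pow_le:
  assumes v: "\<And>j. 0 \<le> v j" and "0 \<le> \<phi>" "M \<le> K"
  shows "conv_pow v m M * \<phi> ^ M \<le> (\<Sum>j\<le>K. v j * \<phi> ^ j) ^ m"
  using assms(3)
proof (induction m arbitrary: M)
  case (Suc m)
  let ?S = "\<Sum>j\<le>K. v j * \<phi> ^ j"
  have "conv_pow v (Suc m) M * \<phi> ^ M
      = (\<Sum>j\<le>M. v j * \<phi> ^ j * (conv_pow v m (M - j) * \<phi> ^ (M - j)))"
    by (auto simp: sum_distrib_right power_add[symmetric] intro!: sum.cong)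
  also have "\<dots> \<le> (\<Sum>j\<le>M. v j * \<phi> ^ j * ?S ^ m)"
    using Suc.prems assms by (intro sum_mono mult_left_mono Suc.IH) auto
  also have "\<dots> \<le> (\<Sum>j\<le>K. v j * \<phi> ^ j * ?S ^ m)"
    using Suc.prems assms by (intro sum_mono2) (auto intro!: mult_nonneg_nonneg zero_le_power sum_nonneg)
  finally show ?case by (simp add: sum_distrib_right)
qed auto

lemma conv_pow_sums:
  assumes v: "\<And>j. 0 \<le> v j" and "0 \<le> \<phi>" and sm: "summable (\<lambda>j. v j * \<phi> ^ j)"
  shows "(\<lambda>s. conv_pow v m s * \<phi> ^ s) sums (\<Sum>j. v j * \<phi> ^ j) ^ m"
proof (induction m)
  case 0
  have "(\<lambda>s. conv_pow v 0 s * \<phi> ^ s) = (\<lambda>s. if s = 0 then 1 else 0)" by auto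
  then show ?case using sums_single[of 0 "\<lambda>_. 1::real"] by simp
next
  case (Suc m)
  have "(\<lambda>s. \<Sum>i\<le>s. (v i * \<phi> ^ i) * (conv_pow v m (s - i) * \<phi> ^ (s - i))) sums
      ((\<Sum>j. v j * \<phi> ^ j) * (\<Sum>s. conv_pow v m s * \<phi> ^ s))"
    using assms Suc by (intro Cauchy_product_sums) (auto simp: conv_pow_nonneg sums_iff abs_mult)
  moreover have "(\<Sum>i\<le>s. (v i * \<phi> ^ i) * (conv_pow v m (s - i) * \<phi> ^ (s - i)))
      = conv_pow v (Suc m) s * \<phi> ^ s" for s
    by (auto simp: sum_distrib_right power_add[symmetric] intro!: sum.cong)
  ultimately show ?case using Suc by (simp add: sums_iff)
qed

section \<open>Tilting the weight of one occupation number\<close>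

lemma conv_pow_Suc_shift:
  "(\<Sum>j\<le>M. v j * (if k \<le> M - j then conv_pow v m (M - j - k) else 0))
     = (if k \<le> M then conv_pow v (Suc m) (M - k) else 0)"
proof (cases "k \<le> M")
  case True
  have "(\<Sum>j\<le>M. v j * (if k \<le> M - j then conv_pow v m (M - j - k) else 0))
      = (\<Sum>j\<le>M - k. v j * conv_pow v m (M - k - j))"
    using True by (intro sum.mono_neutral_cong_right) (auto simp: add.commute)
  with True show ?thesis by simp
qed (auto intro!: sum.neutral)

lemma one_plus_ln_le_powr:
  fixes x \<mu> :: real
  assumes "0 < x"
  shows "1 + \<mu> * ln x \<le> x powr \<mu>"
  using exp_ge_add_one_self[of "\<mu> * ln x"] assms by (simp add: powr_def)

text \<open>Jensen in tangent form: a configuration in which \<open>k\<close> occurs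
  \<open>n\<close> times gains the factor \<open>x ^ n\<close>, which is at least
  \<open>x powr \<mu> * (1 + (n - \<mu>) * ln x)\<close>. Summed over configurations, the number of
  occurrences contributes \<open>m * v k * conv_pow v (m - 1) (M - k)\<close>. The point of tangency
  \<open>\<mu>\<close> stays free because peeling off a site of value \<open>k\<close> shifts it by
  one.\<close>

lemma conv_pow_tilt:
  fixes x \<mu> :: real
  assumes v: "\<And>j. 0 \<le> v j" and x: "0 < x"
  shows "x powr \<mu> * ((1 - \<mu> * ln x) * conv_pow v m M
           + ln x * (real m * v k * (if k \<le> M then conv_pow v (m - 1) (M - k) else 0)))
         \<le> conv_pow (\<lambda>j. v j * (if j = k then x else 1)) m M"
proof (induction m arbitrary: M \<mu>)
  case 0
  have "x powr \<mu> * (1 - \<mu> * ln x) \<le> x powr \<mu> * x powr (- \<mu>)"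
    using one_plus_ln_le_powr[OF x, of "-\<mu>"] by (intro mult_left_mono) auto
  then show ?case using x by (simp add: powr_minus field_simps)
next
  case (Suc m)
  let ?u = "\<lambda>j. v j * (if j = k then x else 1)"
  let ?sh = "\<lambda>m M. if k \<le> M then conv_pow v m (M - k) else 0"
  let ?e = "\<lambda>j. if j = k then 1 else 0 :: real"
  \<comment> \<open>For \<open>m = 0\<close> the factor \<open>real m\<close> makes both sides
    vanish, so the truncated \<open>m - 1\<close> does no harm.\<close>
  have sh: "(\<Sum>j\<le>M. v j * (real m * v k * ?sh (m - 1) (M - j))) = real m * v k * ?sh m M"
  proof (cases m)
    case (Suc m')
    have "(\<Sum>j\<le>M. v j * (real m * v k * ?sh (m - 1) (M - j)))
        = real m * v k * (\<Sum>j\<le>M. v j * ?sh m' (M - j))"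
      unfolding sum_distrib_left by (rule sum.cong) (auto simp: Suc)
    then show ?thesis using Suc conv_pow_Suc_shift[where M = M and v = v and k = k and m = m'] by (simp del: conv_pow.simps)
  qed auto
  have one: "(\<Sum>j\<le>M. v j * (?e j * conv_pow v m (M - j))) = v k * ?sh m M"
  proof -
    have "(\<Sum>j\<le>M. v j * (?e j * conv_pow v m (M - j)))
        = (\<Sum>j\<le>M. if j = k then v k * conv_pow v m (M - k) else 0)"
      by (rule sum.cong) auto
    then show ?thesis by simp
  qed
  have "x powr \<mu> * ((1 - \<mu> * ln x) * conv_pow v (Suc m) M + ln x * (real (Suc m) * v k * ?sh m M))
      = x powr \<mu> * ((1 - \<mu> * ln x) * (\<Sum>j\<le>M. v j * conv_pow v m (M - j))
          + ln x * (\<Sum>j\<le>M. v j * (?e j * conv_pow v m (M - j)))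
          + ln x * (\<Sum>j\<le>M. v j * (real m * v k * ?sh (m - 1) (M - j))))"
    unfolding sh one by (simp add: algebra_simps)
  \<comment> \<open>The occurrence at the peeled site moves the point of tangency to
    \<open>\<mu> - ?e j\<close>; the factor \<open>x\<close> split off next, when
    \<open>j = k\<close>, is the tilt of that site.\<close>
  also have "\<dots> = (\<Sum>j\<le>M. v j * (x powr \<mu> * ((1 - (\<mu> - ?e j) * ln x) * conv_pow v m (M - j)
          + ln x * (real m * v k * ?sh (m - 1) (M - j)))))"
    unfolding sum_distrib_left sum.distrib[symmetric]
    by (rule sum.cong[OF refl]) (simp add: algebra_simps)
  also have "\<dots> = (\<Sum>j\<le>M. ?u j * (x powr (\<mu> - ?e j) * ((1 - (\<mu> - ?e j) * ln x) * conv_pow v m (M - j)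
          + ln x * (real m * v k * ?sh (m - 1) (M - j)))))"
    using x by (intro sum.cong[OF refl]) (simp add: powr_diff)
  also have "\<dots> \<le> (\<Sum>j\<le>M. ?u j * conv_pow ?u m (M - j))"
    using v x by (intro sum_mono mult_left_mono Suc.IH) auto
  finally show ?case by (simp only: conv_pow.simps(2) diff_Suc_1)
qed

text \<open>Tilting bounds the tilted coefficient from below and \<open>conv_pow_le\<close> bounds
  it from above; logarithms per site are compared. The reference value \<open>z\<close> is later
  \<open>bulk_z w \<Phi>\<close>, and the last bracket is the shortfall of the coefficient from its
  exponential rate.\<close>

lemma site_prob_upper:
  fixes x \<phi> z :: real
  assumes v: "\<And>j. 0 < v j" and x: "0 < x" and \<phi>: "0 < \<phi>" and m: "0 < m" and k: "k \<le> M" and z: "0 < z"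
  defines "q \<equiv> v k * conv_pow v (m - 1) (M - k) / conv_pow v m M"
  shows "q * ln x \<le> ((\<Sum>j\<le>M. v j * \<phi> ^ j) + (x - 1) * (v k * \<phi> ^ k)) / z - 1
           + (ln z - real M / real m * ln \<phi> - ln (conv_pow v m M) / real m)"
proof -
  let ?u = "\<lambda>j. v j * (if j = k then x else 1)"
  let ?A = "conv_pow v m M"
  let ?S = "\<Sum>j\<le>M. ?u j * \<phi> ^ j"
  have A: "0 < ?A" using v m by (rule conv_pow_pos)
  have u: "0 < ?u j" for j using v x by auto
  \<comment> \<open>\<open>m * q\<close> is the expected number of sites with value
    \<open>k\<close>; with tangency there, the terms linear in \<open>ln x\<close> cancel.\<close>
  have "real m * v k * conv_pow v (m - 1) (M - k) = real m * q * ?A"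
    using A by (simp add: q_def)
  then have "x powr (real m * q) * ?A \<le> conv_pow ?u m M"
    using conv_pow_tilt[of v x "real m * q", where m = m and M = M and k = k] less_imp_le[OF v] x k m
    by (simp add: algebra_simps)
  then have "x powr (real m * q) * ?A * \<phi> ^ M \<le> conv_pow ?u m M * \<phi> ^ M"
    using \<phi> by (intro mult_right_mono) auto
  also have "\<dots> \<le> ?S ^ m"
    by (rule conv_pow_le[OF less_imp_le[OF u] less_imp_le[OF \<phi>] order_refl])
  finally have le: "x powr (real m * q) * ?A * \<phi> ^ M \<le> ?S ^ m" .
  have S: "0 < ?S" using u \<phi> by (intro sum_pos) auto
  have "ln (x powr (real m * q) * ?A * \<phi> ^ M) \<le> ln (?S ^ m)"
    using le A x \<phi> by (intro ln_mono) auto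
  then have "real m * q * ln x + ln ?A + real M * ln \<phi> \<le> real m * ln ?S"
    using A x \<phi> S by (simp add: ln_mult ln_realpow ln_powr)
  then have "(real m * q * ln x + ln ?A + real M * ln \<phi>) / real m \<le> real m * ln ?S / real m"
    by (intro divide_right_mono) auto
  then have "q * ln x \<le> ln ?S - real M / real m * ln \<phi> - ln ?A / real m"
    using m by (simp add: add_divide_distrib)
  \<comment> \<open>Concavity of \<open>ln\<close> makes the bound linear in the generating
    function, so the tilt enters only through the single term
    \<open>(x - 1) * (v k * \<phi> ^ k)\<close>.\<close>
  moreover have "ln ?S \<le> ln z + (?S / z - 1)"
    using ln_le_minus_one[of "?S / z"] S z by (simp add: ln_div)
  moreover have "?S = (\<Sum>j\<le>M. v j * \<phi> ^ j) + (\<Sum>j\<le>M. if j = k then (x - 1) * (v k * \<phi> ^ k) else 0)"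
    unfolding sum.distrib[symmetric] by (rule sum.cong) (auto simp: algebra_simps)
  ultimately show ?thesis using k by simp
qed

section \<open>Bulk weights\<close>

locale bulk_weights =
  fixes w :: "nat \<Rightarrow> real" and \<phi>bar :: ereal
  assumes w_nonneg: "0 \<le> w n"
    and phibar: "1 < \<phi>bar"
    and bulk_radius: "0 \<le> \<phi> \<Longrightarrow> summable (\<lambda>n. w n * \<phi> ^ n) \<longleftrightarrow> ereal \<phi> < \<phi>bar"
    and bulk_normalized: "w sums 1"
    and R_onto: "0 \<le> r \<Longrightarrow> \<exists>\<phi>\<ge>0. ereal \<phi> < \<phi>bar \<and> bulk_R w \<phi> = r"
begin

lemma le_1_less_phibar: "\<phi> \<le> 1 \<Longrightarrow> ereal \<phi> < \<phi>bar"
  using phibar le_less_trans[of "ereal \<phi>" 1 \<phi>bar] by simp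

lemma phibar_room:
  assumes "ereal \<phi> < \<phi>bar"
  obtains K where "\<phi> < K" "1 < K" "ereal K < \<phi>bar"
proof -
  have "max (ereal \<phi>) 1 < \<phi>bar" using assms phibar by simp
  then obtain K where "max (ereal \<phi>) 1 < ereal K" "ereal K < \<phi>bar"
    using ereal_dense2 by blast
  then show ?thesis using that[of K] by (auto simp: one_ereal_def)
qed

lemma summable_bulk: "0 \<le> \<phi> \<Longrightarrow> ereal \<phi> < \<phi>bar \<Longrightarrow> summable (\<lambda>n. w n * \<phi> ^ n)"
  using bulk_radius by blast

lemma summable_bulk_deriv:
  assumes "0 \<le> \<phi>" "ereal \<phi> < \<phi>bar"
  shows "summable (\<lambda>n. real n * w n * \<phi> ^ n)"
proof -
  obtain K where K: "\<phi> < K" "1 < K" "ereal K < \<phi>bar" using phibar_room assms(2) by blast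
  then have smK: "summable (\<lambda>n. w n * K ^ n)" by (intro summable_bulk) auto
  have "summable (\<lambda>n. diffs w n * \<phi> ^ n)"
  proof (rule termdiff_converges)
    fix x :: real assume "norm x < K"
    then show "summable (\<lambda>n. w n * x ^ n)"
      using powser_inside[OF smK] K by simp
  qed (use assms K in auto)
  then have "summable (\<lambda>n. \<phi> * (real (Suc n) * w (Suc n) * \<phi> ^ n))"
    unfolding diffs_def by (rule summable_mult)
  then have "summable (\<lambda>n. real (Suc n) * w (Suc n) * \<phi> ^ Suc n)"
    by (simp add: mult_ac)
  then show ?thesis by (subst (asm) summable_Suc_iff)
qed

lemma bulk_z_isCont:
  assumes "0 \<le> \<phi>" "ereal \<phi> < \<phi>bar"
  shows "isCont (bulk_z w) \<phi>"
proof -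
  obtain K where K: "\<phi> < K" "1 < K" "ereal K < \<phi>bar" using phibar_room assms(2) by blast
  then have "summable (\<lambda>n. w n * K ^ n)" by (intro summable_bulk) auto
  moreover have "norm \<phi> < norm K" using assms K by simp
  ultimately have "isCont (\<lambda>x. \<Sum>n. w n * x ^ n) \<phi>" by (rule isCont_powser)
  then show ?thesis by (simp add: bulk_z_def[abs_def])
qed

lemma bulk_z_1: "bulk_z w 1 = 1"
  using bulk_normalized by (simp add: bulk_z_def sums_iff)

lemma bulk_R_1: "bulk_R w 1 = crit_density w"
  by (simp add: bulk_R_def bulk_z_1 crit_density_def)

text \<open>Without empty sites every site would carry at least one particle, so the density could
  not take the value \<open>1/2\<close>, which \<open>R_onto\<close> provides.\<close>

lemma w0_pos: "0 < w 0"
proof (rule ccontr)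
  assume "\<not> 0 < w 0"
  then have w0: "w 0 = 0" using w_nonneg[of 0] by linarith
  obtain \<phi> where \<phi>: "0 \<le> \<phi>" "ereal \<phi> < \<phi>bar" "bulk_R w \<phi> = 1/2"
    using R_onto[of "1/2"] by auto
  have "bulk_z w \<phi> \<le> (\<Sum>n. real n * w n * \<phi> ^ n)"
    unfolding bulk_z_def
  proof (intro suminf_le summable_bulk summable_bulk_deriv \<phi>)
    fix n show "w n * \<phi> ^ n \<le> real n * w n * \<phi> ^ n"
      using \<phi>(1) w0 w_nonneg[of n] by (cases n) (auto simp: algebra_simps)
  qed
  moreover have "0 \<le> bulk_z w \<phi>" unfolding bulk_z_def
    using \<phi> w_nonneg by (intro suminf_nonneg summable_bulk) auto
  \<comment> \<open>If \<open>bulk_z w \<phi>\<close> vanished, division by zero would give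
    \<open>bulk_R w \<phi> = 0\<close>, which also differs from \<open>1/2\<close>.\<close>
  ultimately show False using \<phi>(3)
    by (cases "bulk_z w \<phi> = 0") (auto simp: bulk_R_def field_simps)
qed

lemma w0_le_bulk_z:
  assumes "0 \<le> \<phi>" "ereal \<phi> < \<phi>bar"
  shows "w 0 \<le> bulk_z w \<phi>"
  using sum_le_suminf[OF summable_bulk[OF assms], of "{0}"] assms w_nonneg
  by (auto simp: bulk_z_def)

lemma bulk_z_pos: "0 \<le> \<phi> \<Longrightarrow> ereal \<phi> < \<phi>bar \<Longrightarrow> 0 < bulk_z w \<phi>"
  using w0_le_bulk_z w0_pos less_le_trans by blast

lemma bulk_z_mult_R:
  assumes "0 \<le> \<phi>" "ereal \<phi> < \<phi>bar"
  shows "(\<lambda>n. real n * w n * \<phi> ^ n) sums (bulk_z w \<phi> * bulk_R w \<phi>)"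
  using summable_bulk_deriv[OF assms] bulk_z_pos[OF assms] by (simp add: bulk_R_def sums_iff)

lemma bulk_z_sums:
  assumes "0 \<le> \<phi>" "ereal \<phi> < \<phi>bar"
  shows "(\<lambda>n. w n * \<phi> ^ n) sums bulk_z w \<phi>"
  using summable_bulk[OF assms] by (simp add: bulk_z_def sums_iff)

text \<open>In the variable \<open>ln \<phi>\<close> the function \<open>ln z\<close> is convex with slope \<open>R\<close>.\<close>

lemma ln_bulk_z_tangent:
  assumes \<phi>: "0 < \<phi>" "ereal \<phi> < \<phi>bar" and \<psi>: "0 < \<psi>" "ereal \<psi> < \<phi>bar"
  shows "ln (bulk_z w \<phi>) + bulk_R w \<phi> * (ln \<psi> - ln \<phi>) \<le> ln (bulk_z w \<psi>)"
    and "\<phi> \<noteq> \<psi> \<Longrightarrow> bulk_R w \<phi> \<noteq> 0 \<Longrightarrow>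
      ln (bulk_z w \<phi>) + bulk_R w \<phi> * (ln \<psi> - ln \<phi>) < ln (bulk_z w \<psi>)"
proof -
  define x where "x = \<psi> / \<phi>"
  define \<mu> where "\<mu> = bulk_R w \<phi>"
  have x: "0 < x" "ln x = ln \<psi> - ln \<phi>" using \<phi> \<psi> by (auto simp: x_def ln_div)
  \<comment> \<open>\<open>?d n\<close> is the gap between \<open>w n * \<psi> ^ n\<close> and its
    tangent bound, as in \<open>conv_pow_tilt\<close>. Taking the mean
    \<open>bulk_R w \<phi>\<close> as point of tangency removes the linear term after
    summation.\<close>
  let ?d = "\<lambda>n. w n * \<psi> ^ n - x powr \<mu> * ((1 - \<mu> * ln x) * (w n * \<phi> ^ n) + ln x * (real n * w n * \<phi> ^ n))"
  have d: "?d n = w n * \<psi> ^ n * (1 - x powr (\<mu> - real n) * (1 - (\<mu> - real n) * ln x))" for n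
  proof -
    have "\<psi> ^ n = x ^ n * \<phi> ^ n" using \<phi> by (simp add: x_def power_divide)
    moreover have "x powr (\<mu> - real n) * x ^ n = x powr \<mu>"
      using x by (simp add: powr_diff powr_realpow)
    ultimately have "\<psi> ^ n * x powr (\<mu> - real n) = x powr \<mu> * \<phi> ^ n"
      by (simp add: mult_ac)
    moreover have "w n * \<psi> ^ n * (1 - x powr (\<mu> - real n) * (1 - (\<mu> - real n) * ln x))
        = w n * \<psi> ^ n - w n * (\<psi> ^ n * x powr (\<mu> - real n)) * (1 - (\<mu> - real n) * ln x)"
      by (simp add: algebra_simps)
    ultimately show ?thesis by (simp add: algebra_simps)
  qed
  have bound: "x powr t * (1 - t * ln x) \<le> 1" for t
  proof -
    have "x powr t * (1 - t * ln x) \<le> x powr t * x powr (- t)"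
      using one_plus_ln_le_powr[OF x(1), of "- t"] by (intro mult_left_mono) auto
    then show ?thesis using x by (simp add: powr_minus)
  qed
  have d_nonneg: "0 \<le> ?d n" for n
    unfolding d using \<psi> w_nonneg[of n] bound[of "\<mu> - real n"] by (intro mult_nonneg_nonneg) auto
  have "?d sums (bulk_z w \<psi> - x powr \<mu> * ((1 - \<mu> * ln x) * bulk_z w \<phi> + ln x * (bulk_z w \<phi> * bulk_R w \<phi>)))"
    using \<phi> \<psi> by (intro sums_diff sums_mult sums_add bulk_z_sums bulk_z_mult_R) auto
  then have sums: "?d sums (bulk_z w \<psi> - x powr \<mu> * bulk_z w \<phi>)"
    by (simp add: \<mu>_def algebra_simps)
  have z: "0 < bulk_z w \<psi>" "0 < bulk_z w \<phi>" using bulk_z_pos \<phi> \<psi> by auto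
  have ln_eq: "ln (x powr \<mu> * bulk_z w \<phi>) = ln (bulk_z w \<phi>) + bulk_R w \<phi> * (ln \<psi> - ln \<phi>)"
    using z x by (simp add: ln_mult ln_powr \<mu>_def)
  have "x powr \<mu> * bulk_z w \<phi> \<le> bulk_z w \<psi>"
    using sums_le[OF d_nonneg sums_zero sums] by simp
  then show "ln (bulk_z w \<phi>) + bulk_R w \<phi> * (ln \<psi> - ln \<phi>) \<le> ln (bulk_z w \<psi>)"
    unfolding ln_eq[symmetric] using z x by (intro ln_mono) auto
  \<comment> \<open>Strictness comes from the term \<open>n = 0\<close> alone: its weight
    \<open>w 0\<close> is positive, and \<open>\<mu> * ln x \<noteq> 0\<close> makes the exponential
    inequality strict.\<close>
  assume "\<phi> \<noteq> \<psi>" "bulk_R w \<phi> \<noteq> 0"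
  then have t: "\<mu> * ln x \<noteq> 0" using \<phi> \<psi> x by (auto simp: \<mu>_def)
  have "1 - \<mu> * ln x < exp (- (\<mu> * ln x))"
    using exp_minus_greater[of "\<mu> * ln x"] t by simp
  then have "x powr \<mu> * (1 - \<mu> * ln x) < 1"
  proof -
    have "exp (\<mu> * ln x) * (1 - \<mu> * ln x) < exp (\<mu> * ln x) * exp (- (\<mu> * ln x))"
      using \<open>1 - \<mu> * ln x < exp (- (\<mu> * ln x))\<close> by (intro mult_strict_left_mono) auto
    then show ?thesis using x(1) by (simp add: powr_def exp_minus)
  qed
  then have "0 < ?d 0" unfolding d using w0_pos by simp
  then have "0 < bulk_z w \<psi> - x powr \<mu> * bulk_z w \<phi>"
    using suminf_pos2[of ?d 0] sums d_nonneg by (auto simp: sums_iff)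
  then show "ln (bulk_z w \<phi>) + bulk_R w \<phi> * (ln \<psi> - ln \<phi>) < ln (bulk_z w \<psi>)"
    unfolding ln_eq[symmetric] using z x by (subst ln_less_cancel_iff) auto
qed

text \<open>Adding the tangent inequalities at the two fugacities cancels \<open>ln z\<close> and
  leaves the monotonicity of the slope. The strict version below uses one strict tangent.\<close>

lemma bulk_R_mono:
  assumes "0 < \<phi>" "\<phi> \<le> \<psi>" "ereal \<psi> < \<phi>bar"
  shows "bulk_R w \<phi> \<le> bulk_R w \<psi>"
proof (cases "\<phi> = \<psi>")
  case False
  have \<phi>: "ereal \<phi> < \<phi>bar" using assms le_less_trans[of "ereal \<phi>" "ereal \<psi>" \<phi>bar] by simp
  have "bulk_R w \<phi> * (ln \<psi> - ln \<phi>) \<le> bulk_R w \<psi> * (ln \<psi> - ln \<phi>)"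
    using ln_bulk_z_tangent(1)[of \<phi> \<psi>] ln_bulk_z_tangent(1)[of \<psi> \<phi>] assms \<phi>
    by (simp add: algebra_simps)
  then show ?thesis using assms False by (simp add: mult_le_cancel_right)
qed simp

lemma bulk_R_strict_mono:
  assumes "0 < \<phi>" "\<phi> < \<psi>" "ereal \<psi> < \<phi>bar" "bulk_R w \<phi> \<noteq> 0"
  shows "bulk_R w \<phi> < bulk_R w \<psi>"
proof -
  have \<phi>: "ereal \<phi> < \<phi>bar" using assms less_trans[of "ereal \<phi>" "ereal \<psi>" \<phi>bar] by simp
  have "bulk_R w \<phi> * (ln \<psi> - ln \<phi>) < bulk_R w \<psi> * (ln \<psi> - ln \<phi>)"
    using ln_bulk_z_tangent(2)[of \<phi> \<psi>] ln_bulk_z_tangent(1)[of \<psi> \<phi>] assms \<phi>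
    by (simp add: algebra_simps)
  then show ?thesis using assms by (simp add: mult_less_cancel_right)
qed

lemma bulk_R_less_imp_less:
  assumes "0 < \<phi>" "0 < \<psi>" "ereal \<phi> < \<phi>bar" "bulk_R w \<phi> < bulk_R w \<psi>"
  shows "\<phi> < \<psi>"
  using bulk_R_mono[of \<psi> \<phi>] assms by (meson leD leI)

section \<open>Zeros of the density and the fugacity \<open>\<Phi>\<close>\<close>

lemma bulk_R_0: "bulk_R w 0 = 0"
  using suminf_finite[of "{0}" "\<lambda>n. real n * w n * 0 ^ n"] by (simp add: bulk_R_def)

text \<open>Vanishing at some positive fugacity forces \<open>real n * w n = 0\<close> for all
  \<open>n\<close>; then \<open>bulk_R w\<close> vanishes everywhere and cannot attain 1.\<close>

lemma bulk_R_eq_0_iff: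
  assumes "0 \<le> \<phi>" "ereal \<phi> < \<phi>bar"
  shows "bulk_R w \<phi> = 0 \<longleftrightarrow> \<phi> = 0"
proof (rule iffI, rule ccontr)
  assume R: "bulk_R w \<phi> = 0" and "\<phi> \<noteq> 0"
  then have "(\<lambda>n. real n * w n * \<phi> ^ n) sums 0" using bulk_z_mult_R[OF assms] by simp
  then have "real n * w n * \<phi> ^ n = 0" for n
    using suminf_eq_zero_iff[of "\<lambda>n. real n * w n * \<phi> ^ n"] w_nonneg assms(1) by (auto simp: sums_iff)
  then have "real n * w n = 0" for n using \<open>\<phi> \<noteq> 0\<close> by simp
  then have "bulk_R w \<psi> = 0" for \<psi> by (simp only: bulk_R_def) simp
  then show False using R_onto[of 1] by auto
qed (simp add: bulk_R_0)

lemma crit_density_pos: "0 < crit_density w"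
proof -
  have "0 \<le> crit_density w" unfolding bulk_R_1[symmetric]
    using w_nonneg bulk_z_1 summable_bulk_deriv[of 1] le_1_less_phibar[of 1]
    by (auto simp: bulk_R_def intro!: suminf_nonneg)
  then show ?thesis using bulk_R_eq_0_iff[of 1] le_1_less_phibar[of 1] bulk_R_1 by auto
qed

lemma R_onto_pos:
  assumes "0 < r"
  obtains \<phi> where "0 < \<phi>" "ereal \<phi> < \<phi>bar" "bulk_R w \<phi> = r"
proof -
  obtain \<phi> where \<phi>: "0 \<le> \<phi>" "ereal \<phi> < \<phi>bar" "bulk_R w \<phi> = r" using R_onto[of r] assms by auto
  then have "\<phi> \<noteq> 0" using assms bulk_R_0 by auto
  with \<phi> have "0 < \<phi>" by simp
  from that[OF this \<phi>(2,3)] show ?thesis .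
qed

text \<open>The minimum treats both regimes at once. In the subcritical regime a chosen fugacity
  above 1 would have density above \<open>crit_density w\<close>, by strict monotonicity from the
  positive value at 1.\<close>

lemma bulk_Phi:
  assumes "0 \<le> \<rho>"
  defines "\<Phi> \<equiv> bulk_Phi w \<phi>bar \<rho>"
  shows "0 \<le> \<Phi>" "\<Phi> \<le> 1" "bulk_R w \<Phi> = min \<rho> (crit_density w)"
proof -
  have "0 \<le> \<Phi> \<and> \<Phi> \<le> 1 \<and> bulk_R w \<Phi> = min \<rho> (crit_density w)"
  proof (cases "\<rho> \<le> crit_density w")
    case True
    then have "\<Phi> = (SOME \<phi>. 0 \<le> \<phi> \<and> ereal \<phi> < \<phi>bar \<and> bulk_R w \<phi> = \<rho>)"
      by (simp add: \<Phi>_def bulk_Phi_def)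
    then have \<Phi>: "0 \<le> \<Phi>" "ereal \<Phi> < \<phi>bar" "bulk_R w \<Phi> = \<rho>"
      using someI_ex[of "\<lambda>\<phi>. 0 \<le> \<phi> \<and> ereal \<phi> < \<phi>bar \<and> bulk_R w \<phi> = \<rho>"] R_onto[OF assms(1)] by auto
    have "\<Phi> \<le> 1"
    proof (rule ccontr)
      assume "\<not> \<Phi> \<le> 1"
      then have "bulk_R w 1 < bulk_R w \<Phi>"
        using \<Phi> crit_density_pos by (intro bulk_R_strict_mono) (auto simp: bulk_R_1)
      then show False using True \<Phi> bulk_R_1 by simp
    qed
    with \<Phi> True show ?thesis by simp
  next
    case False
    then have "\<Phi> = 1" by (simp add: \<Phi>_def bulk_Phi_def)
    then show ?thesis using False bulk_R_1 by simp
  qed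
  then show "0 \<le> \<Phi>" "\<Phi> \<le> 1" "bulk_R w \<Phi> = min \<rho> (crit_density w)" by auto
qed

end

section \<open>Rate of the partition function\<close>

text \<open>Division by \<open>ln x\<close> gives upper bounds on \<open>q\<close> for
  \<open>x > 1\<close> and, as the sign flips, lower bounds for \<open>x < 1\<close>; both constants
  tend to \<open>p\<close> because \<open>(x - 1) / ln x\<close> tends to 1.\<close>

lemma tilt_bounds_imp_tendsto:
  fixes q :: "nat \<Rightarrow> real" and p :: real
  assumes "\<And>x \<epsilon>. 0 < x \<Longrightarrow> 0 < \<epsilon> \<Longrightarrow> eventually (\<lambda>n. q n * ln x \<le> (x - 1) * p + \<epsilon>) sequentially"
  shows "q \<longlonglongrightarrow> p"
proof (rule order_tendstoI)
  fix a assume a: "p < a"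
  have "((\<lambda>x::real. (x - 1) / ln x) \<longlongrightarrow> 1) (at_right 1)" by real_asymp
  then have "((\<lambda>x::real. (x - 1) / ln x * p) \<longlongrightarrow> 1 * p) (at_right 1)" by (intro tendsto_mult tendsto_const)
  then have "eventually (\<lambda>x. (x - 1) / ln x * p < a) (at_right 1)"
    using a by (auto dest: order_tendstoD(2))
  moreover have "eventually (\<lambda>x. x \<in> {1<..<2}) (at_right (1::real))"
    by (rule eventually_at_right_real) simp
  ultimately have "eventually (\<lambda>x. (x - 1) / ln x * p < a \<and> 1 < x) (at_right 1)"
    by eventually_elim auto
  then obtain x where x: "(x - 1) / ln x * p < a" "1 < x"
    using eventually_happens'[OF trivial_limit_at_right_real] by blast
  \<comment> \<open>Half of the gap, so that the bound stays strictly below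
    \<open>a * ln x\<close>.\<close>
  define \<epsilon> where "\<epsilon> = (a * ln x - (x - 1) * p) / 2"
  have "0 < \<epsilon>" using x by (simp add: \<epsilon>_def field_simps)
  then have "eventually (\<lambda>n. q n * ln x \<le> (x - 1) * p + \<epsilon>) sequentially" using assms x by simp
  then show "eventually (\<lambda>n. q n < a) sequentially"
  proof eventually_elim
    case (elim n)
    then have "q n * ln x < a * ln x" using \<open>0 < \<epsilon>\<close> by (simp add: \<epsilon>_def field_simps)
    then show ?case using x by (simp add: mult_less_cancel_right)
  qed
next
  fix a assume a: "a < p"
  have "((\<lambda>x::real. (x - 1) / ln x) \<longlongrightarrow> 1) (at_left 1)" by real_asymp
  then have "((\<lambda>x::real. (x - 1) / ln x * p) \<longlongrightarrow> 1 * p) (at_left 1)" by (intro tendsto_mult tendsto_const)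
  then have "eventually (\<lambda>x. a < (x - 1) / ln x * p) (at_left 1)"
    using a by (auto dest: order_tendstoD(1))
  moreover have "eventually (\<lambda>x. x \<in> {0<..<1}) (at_left (1::real))"
    by (rule eventually_at_left_real) simp
  ultimately have "eventually (\<lambda>x. a < (x - 1) / ln x * p \<and> 0 < x \<and> x < 1) (at_left 1)"
    by eventually_elim auto
  then obtain x where x: "a < (x - 1) / ln x * p" "0 < x" "x < 1"
    using eventually_happens'[OF trivial_limit_at_left_real] by blast
  define \<epsilon> where "\<epsilon> = (a * ln x - (x - 1) * p) / 2"
  have ln: "ln x < 0" using x by simp
  have "0 < \<epsilon>" using x(1) ln by (simp add: \<epsilon>_def field_simps)
  then have "eventually (\<lambda>n. q n * ln x \<le> (x - 1) * p + \<epsilon>) sequentially" using assms x by simp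
  then show "eventually (\<lambda>n. a < q n) sequentially"
  proof eventually_elim
    case (elim n)
    then have "q n * ln x < a * ln x" using \<open>0 < \<epsilon>\<close> by (simp add: \<epsilon>_def field_simps)
    then show ?case using ln by (simp add: mult_less_cancel_right)
  qed
qed

section \<open>Chernoff bounds and the exponential rate for the bulk weights\<close>

context bulk_weights
begin

text \<open>Under the product measure at fugacity \<open>\<phi>\<close>, the total over
  \<open>m\<close> sites exceeds \<open>M\<close>, or is at most \<open>\<alpha> * m\<close>, with
  probability at most 1/4 each, by Chernoff bounds with the fugacities \<open>\<phi>1\<close> and
  \<open>\<phi>0\<close>. At least half of the mass remains between them, where
  \<open>\<phi> ^ s\<close> is at most \<open>\<phi> powr (\<alpha> * m)\<close> since
  \<open>\<phi> < 1\<close>.\<close>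

lemma conv_pow_partial_sum_lower:
  assumes \<phi>: "0 < \<phi>0" "\<phi>0 < \<phi>" "\<phi> < \<phi>1" "\<phi>1 \<le> 1"
    and \<alpha>: "\<alpha> < bulk_R w \<phi>0" and r: "bulk_R w \<phi>1 < r"
  shows "eventually (\<lambda>m. \<forall>M. r * real m \<le> real M \<longrightarrow>
           bulk_z w \<phi> ^ m / 2 \<le> \<phi> powr (\<alpha> * real m) * (\<Sum>s\<le>M. conv_pow w m s)) sequentially"
proof -
  let ?z = "bulk_z w"
  note less_phibar = le_1_less_phibar
  \<comment> \<open>\<open>c1\<close> and \<open>c0\<close> are the decay rates of the two tails.
    They are positive because the tangent at \<open>\<phi>1\<close>, steepened to slope
    \<open>r\<close>, lies strictly below \<open>ln z\<close> at \<open>\<phi> < \<phi>1\<close>,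
    and so does the tangent at \<open>\<phi>0\<close>, flattened to slope \<open>\<alpha>\<close>,
    at \<open>\<phi> > \<phi>0\<close>.\<close>
  define c1 where "c1 = ln (?z \<phi>) - (ln (?z \<phi>1) + r * (ln \<phi> - ln \<phi>1))"
  define c0 where "c0 = ln (?z \<phi>) - (ln (?z \<phi>0) + \<alpha> * (ln \<phi> - ln \<phi>0))"
  have z: "0 < ?z \<phi>" "0 < ?z \<phi>0" "0 < ?z \<phi>1"
    using \<phi> by (auto intro!: bulk_z_pos less_phibar)
  have "ln (?z \<phi>1) + bulk_R w \<phi>1 * (ln \<phi> - ln \<phi>1) \<le> ln (?z \<phi>)"
    using \<phi> by (intro ln_bulk_z_tangent less_phibar) auto
  moreover have "0 < (r - bulk_R w \<phi>1) * (ln \<phi>1 - ln \<phi>)" using \<phi> r by (intro mult_pos_pos) auto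
  ultimately have c1: "0 < c1" by (simp add: c1_def algebra_simps)
  have "ln (?z \<phi>0) + bulk_R w \<phi>0 * (ln \<phi> - ln \<phi>0) \<le> ln (?z \<phi>)"
    using \<phi> by (intro ln_bulk_z_tangent less_phibar) auto
  moreover have "0 < (bulk_R w \<phi>0 - \<alpha>) * (ln \<phi> - ln \<phi>0)" using \<phi> \<alpha> by (intro mult_pos_pos) auto
  ultimately have c0: "0 < c0" by (simp add: c0_def algebra_simps)
  have ev: "eventually (\<lambda>m. exp (- c * real m) \<le> 1 / 4) sequentially" if "0 < c" for c
  proof -
    have "(\<lambda>m. exp (- c * real m)) \<longlonglongrightarrow> 0" using that by real_asymp
    then have "eventually (\<lambda>m. exp (- c * real m) < 1 / 4) sequentially"
      by (rule order_tendstoD) simp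
    then show ?thesis by eventually_elim simp
  qed
  have pow_split: "\<phi> ^ s = \<psi> ^ s * (\<phi> / \<psi>) powr real s" if "0 < \<psi>" for \<psi> and s :: nat
    using that \<phi> by (simp add: powr_realpow power_divide)
  have tail: "?z \<psi> ^ m * (\<phi> / \<psi>) powr (t * real m) = ?z \<phi> ^ m * exp (- (ln (?z \<phi>) - (ln (?z \<psi>) + t * (ln \<phi> - ln \<psi>))) * real m)"
    if "0 < \<psi>" "0 < ?z \<psi>" for \<psi> t m
  proof -
    have "?z \<psi> ^ m = exp (real m * ln (?z \<psi>))" "?z \<phi> ^ m = exp (real m * ln (?z \<phi>))"
      using that z by (simp_all add: exp_of_nat_mult)
    then show ?thesis using that \<phi> by (simp add: powr_def ln_div exp_add[symmetric] algebra_simps)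
  qed
  show ?thesis using ev[OF c1] ev[OF c0]
  proof eventually_elim
    case (elim m)
    show ?case
    proof (intro allI impI)
      fix M assume M: "r * real m \<le> real M"
      let ?a = "conv_pow w m"
      let ?P1 = "(\<phi> / \<phi>1) powr (r * real m)" and ?P0 = "(\<phi> / \<phi>0) powr (\<alpha> * real m)"
      let ?Q = "\<phi> powr (\<alpha> * real m)"
      have a: "0 \<le> ?a s" for s using w_nonneg by (intro conv_pow_nonneg) auto
      have sums: "(\<lambda>s. ?a s * \<psi> ^ s) sums (?z \<psi> ^ m)" if "0 < \<psi>" "\<psi> \<le> 1" for \<psi>
        unfolding bulk_z_def using that by (intro conv_pow_sums w_nonneg summable_bulk less_phibar) auto
      \<comment> \<open>The three summands dominate the middle range, the upper tail and the lower
        tail, in this order.\<close>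
      have le: "?a s * \<phi> ^ s \<le> (if s \<in> {..M} then ?a s * ?Q else 0) + ?a s * \<phi>1 ^ s * ?P1 + ?a s * \<phi>0 ^ s * ?P0" for s
      proof -
        have n: "0 \<le> (if s \<in> {..M} then ?a s * ?Q else 0)" "0 \<le> ?a s * \<phi>1 ^ s * ?P1" "0 \<le> ?a s * \<phi>0 ^ s * ?P0"
          using a[of s] \<phi> by auto
        consider "M < s" | "s \<le> M" "real s \<le> \<alpha> * real m" | "s \<le> M" "\<alpha> * real m \<le> real s" by linarith
        then show ?thesis
        proof cases
          case 1
          have "(\<phi> / \<phi>1) powr real s \<le> ?P1"
            using 1 M \<phi> by (intro powr_mono') auto
          then have "?a s * \<phi>1 ^ s * (\<phi> / \<phi>1) powr real s \<le> ?a s * \<phi>1 ^ s * ?P1"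
            using a \<phi> by (intro mult_left_mono) auto
          moreover have "?a s * \<phi> ^ s = ?a s * \<phi>1 ^ s * (\<phi> / \<phi>1) powr real s"
            using pow_split[of \<phi>1 s] \<phi> by simp
          ultimately show ?thesis using n by linarith
        next
          case 2
          have "(\<phi> / \<phi>0) powr real s \<le> ?P0"
            using 2 \<phi> by (intro powr_mono) auto
          then have "?a s * \<phi>0 ^ s * (\<phi> / \<phi>0) powr real s \<le> ?a s * \<phi>0 ^ s * ?P0"
            using a \<phi> by (intro mult_left_mono) auto
          moreover have "?a s * \<phi> ^ s = ?a s * \<phi>0 ^ s * (\<phi> / \<phi>0) powr real s"
            using pow_split[of \<phi>0 s] \<phi> by simp
          ultimately show ?thesis using n by linarith
        next
          case 3
          have "\<phi> powr real s \<le> ?Q" using 3 \<phi> by (intro powr_mono') auto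
          then have "?a s * \<phi> ^ s \<le> ?a s * ?Q"
            using a \<phi> by (intro mult_left_mono) (auto simp: powr_realpow)
          then show ?thesis using n 3 by auto
        qed
      qed
      have "(\<lambda>s. (if s \<in> {..M} then ?a s * ?Q else 0) + ?a s * \<phi>1 ^ s * ?P1 + ?a s * \<phi>0 ^ s * ?P0) sums
          ((\<Sum>s\<le>M. ?a s * ?Q) + ?z \<phi>1 ^ m * ?P1 + ?z \<phi>0 ^ m * ?P0)"
        using \<phi> by (intro sums_add sums_mult2 sums sums_If_finite_set) auto
      with le sums[of \<phi>] have "?z \<phi> ^ m \<le> (\<Sum>s\<le>M. ?a s * ?Q) + ?z \<phi>1 ^ m * ?P1 + ?z \<phi>0 ^ m * ?P0"
        using \<phi> by (intro sums_le[OF le]) auto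
      moreover have "?z \<phi>1 ^ m * ?P1 \<le> ?z \<phi> ^ m * (1 / 4)"
        using tail[of \<phi>1 m r] elim(1) \<phi> z unfolding c1_def by (auto intro!: mult_left_mono)
      moreover have "?z \<phi>0 ^ m * ?P0 \<le> ?z \<phi> ^ m * (1 / 4)"
        using tail[of \<phi>0 m \<alpha>] elim(2) \<phi> z unfolding c0_def by (auto intro!: mult_left_mono)
      moreover have "(\<Sum>s\<le>M. ?a s * ?Q) = ?Q * (\<Sum>s\<le>M. ?a s)"
        by (simp add: sum_distrib_right mult.commute)
      ultimately show "?z \<phi> ^ m / 2 \<le> ?Q * (\<Sum>s\<le>M. ?a s)" by linarith
    qed
  qed
qed

text \<open>The Chernoff bound is applied at a fugacity slightly below \<open>\<Phi>\<close>, where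
  the typical density is strictly below \<open>\<rho>\<close>. The slack \<open>r < \<rho>\<close>
  is what allows a particle density that merely converges to \<open>\<rho>\<close>.\<close>

lemma conv_pow_partial_sum_rate:
  assumes \<rho>: "0 \<le> \<rho>" and \<epsilon>: "0 < \<epsilon>"
  defines "\<Phi> \<equiv> bulk_Phi w \<phi>bar \<rho>"
  shows "\<exists>r<\<rho>. eventually (\<lambda>m. \<forall>M. r * real m \<le> real M \<longrightarrow>
           real m * (ln (bulk_z w \<Phi>) - \<rho> * ln \<Phi> - \<epsilon>) \<le> ln (\<Sum>s\<le>M. conv_pow w m s)) sequentially"
proof (cases "\<rho> = 0")
  case True
  have \<Phi>0: "\<Phi> = 0"
    using bulk_Phi[of \<rho>] \<rho> True crit_density_pos bulk_R_eq_0_iff[of \<Phi>] le_1_less_phibar[of \<Phi>]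
    by (auto simp: \<Phi>_def)
  have z0: "bulk_z w \<Phi> = w 0"
    using powser_zero[of w] by (simp add: \<Phi>0 bulk_z_def)
  have "real m * (ln (w 0) - \<epsilon>) \<le> ln (\<Sum>s\<le>M. conv_pow w m s)" for m M
  proof -
    have "w 0 ^ m \<le> (\<Sum>s\<le>M. conv_pow w m s)"
      using member_le_sum[of 0 "{..M}" "conv_pow w m"] w_nonneg
      by (auto simp: conv_pow_at_0 intro!: conv_pow_nonneg)
    moreover have "0 < w 0 ^ m" using w0_pos by simp
    ultimately have "ln (w 0 ^ m) \<le> ln (\<Sum>s\<le>M. conv_pow w m s)"
      by (intro ln_mono) auto
    moreover have "real m * (ln (w 0) - \<epsilon>) \<le> real m * ln (w 0)" using \<epsilon> by (intro mult_left_mono) auto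
    ultimately show ?thesis using w0_pos by (simp add: ln_realpow)
  qed
  \<comment> \<open>The empty configuration alone gives the bound for every \<open>M\<close>, so any
    negative \<open>r\<close> serves.\<close>
  then show ?thesis using z0 True by (intro exI[of _ "-1"]) auto
next
  case False
  define R where "R = bulk_R w \<Phi>"
  have \<Phi>: "0 \<le> \<Phi>" "\<Phi> \<le> 1" "R = min \<rho> (crit_density w)"
    using bulk_Phi[OF \<rho>] by (auto simp: \<Phi>_def R_def)
  have R: "0 < R" "R \<le> \<rho>" using \<Phi> False \<rho> crit_density_pos by auto
  then have \<Phi>_pos: "0 < \<Phi>" using \<Phi> bulk_R_0 by (cases "\<Phi> = 0") (auto simp: R_def)
  \<comment> \<open>Above the critical density \<open>\<Phi> = 1\<close>, so
    \<open>ln \<Phi> = 0\<close> hides the difference between \<open>R\<close> and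
    \<open>\<rho>\<close>.\<close>
  have R_ln: "R * ln \<Phi> = \<rho> * ln \<Phi>"
  proof (cases "\<rho> \<le> crit_density w")
    case False
    then have "\<Phi> = 1" by (simp add: \<Phi>_def bulk_Phi_def)
    then show ?thesis by simp
  qed (use \<Phi> in simp)
  have obt: "\<exists>\<phi>>0. \<phi> < \<Phi> \<and> bulk_R w \<phi> = a" if "0 < a" "a < R" for a
  proof -
    obtain \<phi> where \<phi>: "0 < \<phi>" "ereal \<phi> < \<phi>bar" "bulk_R w \<phi> = a" by (rule R_onto_pos[OF \<open>0 < a\<close>])
    then have "\<phi> < \<Phi>" using that \<Phi>_pos by (auto intro: bulk_R_less_imp_less[of \<phi> \<Phi>] simp: R_def)
    with \<phi> show ?thesis by blast
  qed
  \<comment> \<open>\<open>\<phi>h\<close> is fixed before \<open>\<delta>\<close> and lies below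
    the later \<open>\<phi>\<close>; hence \<open>- ln \<phi> \<le> h\<close> with \<open>h\<close>
    independent of \<open>\<delta>\<close>, and \<open>\<delta>\<close> can be chosen so that
    \<open>\<delta> * h \<le> \<epsilon> / 2\<close>.\<close>
  obtain \<phi>h where \<phi>h: "0 < \<phi>h" "\<phi>h < \<Phi>" "bulk_R w \<phi>h = R / 2" using obt[of "R / 2"] R by auto
  define h where "h = - ln \<phi>h"
  have h: "0 < h" using \<phi>h \<Phi> by (simp add: h_def)
  define \<delta> where "\<delta> = min (R / 2) (\<epsilon> / (2 * h))"
  have \<delta>: "0 < \<delta>" "\<delta> \<le> R / 2" "\<delta> * h \<le> \<epsilon> / 2"
    using R \<epsilon> h by (auto simp: \<delta>_def min_def field_simps)
  \<comment> \<open>The three densities lie strictly between \<open>\<alpha> = R - \<delta>\<close>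
    and \<open>r = R - \<delta> / 8\<close>, which orders the fugacities as the Chernoff bound
    requires.\<close>
  obtain \<phi>0 where \<phi>0: "0 < \<phi>0" "\<phi>0 < \<Phi>" "bulk_R w \<phi>0 = R - 3 * \<delta> / 4" using obt[of "R - 3 * \<delta> / 4"] R \<delta> by auto
  obtain \<phi> where \<phi>: "0 < \<phi>" "\<phi> < \<Phi>" "bulk_R w \<phi> = R - \<delta> / 2" using obt[of "R - \<delta> / 2"] R \<delta> by auto
  obtain \<phi>1 where \<phi>1: "0 < \<phi>1" "\<phi>1 < \<Phi>" "bulk_R w \<phi>1 = R - \<delta> / 4" using obt[of "R - \<delta> / 4"] R \<delta> by auto
  have ord: "\<phi>h < \<phi>" "\<phi>0 < \<phi>" "\<phi> < \<phi>1"
    using bulk_R_less_imp_less[of \<phi>h \<phi>] bulk_R_less_imp_less[of \<phi>0 \<phi>] bulk_R_less_imp_less[of \<phi> \<phi>1]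
      \<phi>h \<phi>0 \<phi> \<phi>1 \<delta> \<Phi> le_1_less_phibar[of \<phi>h] le_1_less_phibar[of \<phi>0] le_1_less_phibar[of \<phi>]
    by simp_all
  have z: "0 < bulk_z w \<phi>" using \<phi> \<Phi> by (intro bulk_z_pos le_1_less_phibar) auto
  have rate: "ln (bulk_z w \<Phi>) - \<rho> * ln \<Phi> - \<epsilon> / 2 \<le> ln (bulk_z w \<phi>) - (R - \<delta>) * ln \<phi>"
  proof -
    \<comment> \<open>The tangent at \<open>\<Phi>\<close> shows that moving to
      \<open>\<phi>\<close> does not lower the rate at slope \<open>R\<close>; only the correction
      \<open>\<delta> * ln \<phi>\<close> is lost.\<close>
    have "ln (bulk_z w \<Phi>) + R * (ln \<phi> - ln \<Phi>) \<le> ln (bulk_z w \<phi>)"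
      using \<phi> \<Phi> unfolding R_def by (intro ln_bulk_z_tangent le_1_less_phibar) auto
    moreover have "- ln \<phi> \<le> h" using ord \<phi>h by (simp add: h_def)
    then have "\<delta> * (- ln \<phi>) \<le> \<epsilon> / 2" using \<delta> mult_left_mono[of "- ln \<phi>" h \<delta>] by linarith
    ultimately show ?thesis using R_ln by (simp add: algebra_simps)
  qed
  have "eventually (\<lambda>m. \<forall>M. (R - \<delta> / 8) * real m \<le> real M \<longrightarrow>
           bulk_z w \<phi> ^ m / 2 \<le> \<phi> powr ((R - \<delta>) * real m) * (\<Sum>s\<le>M. conv_pow w m s)) sequentially"
    using \<phi>0 \<phi>1 ord \<Phi> \<delta> by (intro conv_pow_partial_sum_lower[of \<phi>0 \<phi> \<phi>1]) auto
  \<comment> \<open>The second half of \<open>\<epsilon>\<close> pays for the factor 1/2 in the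
    Chernoff bound.\<close>
  moreover have "eventually (\<lambda>m. ln 2 \<le> real m * (\<epsilon> / 2)) sequentially"
    using \<epsilon> by real_asymp
  ultimately have "eventually (\<lambda>m. \<forall>M. (R - \<delta> / 8) * real m \<le> real M \<longrightarrow>
           real m * (ln (bulk_z w \<Phi>) - \<rho> * ln \<Phi> - \<epsilon>) \<le> ln (\<Sum>s\<le>M. conv_pow w m s)) sequentially"
  proof eventually_elim
    case (elim m)
    show ?case
    proof (intro allI impI)
      fix M assume "(R - \<delta> / 8) * real m \<le> real M"
      then have le: "bulk_z w \<phi> ^ m / 2 \<le> \<phi> powr ((R - \<delta>) * real m) * (\<Sum>s\<le>M. conv_pow w m s)"
        using elim by blast
      have "0 < \<phi> powr ((R - \<delta>) * real m) * (\<Sum>s\<le>M. conv_pow w m s)"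
        using le z by (intro less_le_trans[OF _ le]) auto
      then have B: "0 < (\<Sum>s\<le>M. conv_pow w m s)" using \<phi> by (simp add: zero_less_mult_iff)
      have "ln (bulk_z w \<phi> ^ m / 2) \<le> ln (\<phi> powr ((R - \<delta>) * real m) * (\<Sum>s\<le>M. conv_pow w m s))"
        using le z by (intro ln_mono) auto
      then have "real m * ln (bulk_z w \<phi>) - ln 2 \<le> (R - \<delta>) * real m * ln \<phi> + ln (\<Sum>s\<le>M. conv_pow w m s)"
        using z B \<phi> by (simp add: ln_div ln_mult ln_realpow ln_powr)
      moreover have "real m * (ln (bulk_z w \<Phi>) - \<rho> * ln \<Phi> - \<epsilon> / 2) \<le> real m * (ln (bulk_z w \<phi>) - (R - \<delta>) * ln \<phi>)"
        using rate by (intro mult_left_mono) auto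
      ultimately show "real m * (ln (bulk_z w \<Phi>) - \<rho> * ln \<Phi> - \<epsilon>) \<le> ln (\<Sum>s\<le>M. conv_pow w m s)"
        using elim(2) by (simp add: algebra_simps)
    qed
  qed
  then show ?thesis using R \<delta> by (intro exI[of _ "R - \<delta> / 8"]) auto
qed

end

section \<open>Convergence of canonical probabilities\<close>

text \<open>The properties of the perturbed weights that enter the limit. \<open>lb L\<close> bounds
  from below the weight of one site holding any number of particles up to \<open>N L\<close>; by
  \<open>lb_subexp\<close>, piling up the excess there is free on the exponential scale.\<close>

locale thermodynamic_limit = bulk_weights w \<phi>bar
  for w :: "nat \<Rightarrow> real" and \<phi>bar :: ereal +
  fixes v :: "nat \<Rightarrow> nat \<Rightarrow> real" and N :: "nat \<Rightarrow> nat" and \<rho> :: real and lb :: "nat \<Rightarrow> real"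
  assumes rho: "0 \<le> \<rho>"
    and v_pos: "1 \<le> L \<Longrightarrow> 0 < v L n"
    and bulk_le: "eventually (\<lambda>L. \<forall>n\<le>N L. w n \<le> v L n) sequentially"
    and lb_le: "eventually (\<lambda>L. \<forall>n\<le>N L. lb L \<le> v L n) sequentially"
    and lb_pos: "eventually (\<lambda>L. 0 < lb L) sequentially"
    and lb_subexp: "(\<lambda>L. ln (lb L) / real L) \<longlonglongrightarrow> 0"
    and v_tendsto: "(\<lambda>L. v L n) \<longlonglongrightarrow> w n"
    and v_upper: "0 < \<phi> \<Longrightarrow> \<phi> < 1 \<Longrightarrow> 0 < \<epsilon> \<Longrightarrow>
      eventually (\<lambda>L. (\<Sum>j\<le>N L. v L j * \<phi> ^ j) \<le> bulk_z w \<phi> + \<epsilon>) sequentially"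
    and density: "(\<lambda>L. real (N L) / real L) \<longlonglongrightarrow> \<rho>"
    and N_at_top: "filterlim N at_top sequentially"
begin

abbreviation \<Phi> :: real where "\<Phi> \<equiv> bulk_Phi w \<phi>bar \<rho>"

text \<open>Fixing \<open>d\<close> sites that hold \<open>c\<close> particles in total does not
  change the limiting density of the rest.\<close>

lemma density_shift: "(\<lambda>L. real (N L - c) / real (L - d)) \<longlonglongrightarrow> \<rho>"
proof -
  have "(\<lambda>L. (real (N L) / real L - real c / real L) * (real L / (real L - real d))) \<longlonglongrightarrow> (\<rho> - 0) * 1"
  proof (intro tendsto_mult tendsto_diff density)
    show "(\<lambda>L. real c / real L) \<longlonglongrightarrow> 0" by real_asymp
    show "(\<lambda>L. real L / (real L - real d)) \<longlonglongrightarrow> 1" by real_asymp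
  qed
  moreover have "eventually (\<lambda>L. (real (N L) / real L - real c / real L) * (real L / (real L - real d))
      = real (N L - c) / real (L - d)) sequentially"
    using eventually_gt_at_top[of d] filterlim_at_top[THEN iffD1, OF N_at_top, rule_format, of c]
  proof eventually_elim
    case (elim L)
    then show ?case by (simp add: diff_divide_distrib[symmetric] of_nat_diff)
  qed
  ultimately show ?thesis by (auto intro: Lim_transform_eventually)
qed

lemma lb_subexp_shift: "(\<lambda>L. ln (lb L) / real (L - d)) \<longlonglongrightarrow> 0"
proof -
  have "(\<lambda>L. (ln (lb L) / real L) * (real L / (real L - real d))) \<longlonglongrightarrow> 0 * 1"
  proof (intro tendsto_mult lb_subexp)
    show "(\<lambda>L. real L / (real L - real d)) \<longlonglongrightarrow> 1" by real_asymp
  qed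
  moreover have "eventually (\<lambda>L. (ln (lb L) / real L) * (real L / (real L - real d))
      = ln (lb L) / real (L - d)) sequentially"
    using eventually_gt_at_top[of d]
  proof eventually_elim
    case (elim L)
    then show ?case by (simp add: of_nat_diff)
  qed
  ultimately show ?thesis by (auto intro: Lim_transform_eventually)
qed

text \<open>A single site can absorb the particles that the remaining ones leave over.\<close>

lemma conv_pow_ge_partial_sum:
  assumes w: "\<forall>n\<le>K. w n \<le> v L n" and l: "\<forall>n\<le>K. lb L \<le> v L n" and "0 \<le> lb L" and M: "M \<le> K"
  shows "lb L * (\<Sum>s\<le>M. conv_pow w m s) \<le> conv_pow (v L) (Suc m) M"
proof -
  have "lb L * (\<Sum>s\<le>M. conv_pow w m s) = (\<Sum>j\<le>M. lb L * conv_pow w m (M - j))"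
    unfolding sum_distrib_left by (rule sum.reindex_bij_witness[of _ "\<lambda>j. M - j" "\<lambda>j. M - j"]) auto
  also have "\<dots> \<le> (\<Sum>j\<le>M. v L j * conv_pow (v L) m (M - j))"
  proof (intro sum_mono mult_mono)
    fix j assume j: "j \<in> {..M}"
    then show "lb L \<le> v L j" using l M by auto
    then show "0 \<le> v L j" using \<open>0 \<le> lb L\<close> by linarith
    show "conv_pow w m (M - j) \<le> conv_pow (v L) m (M - j)"
      using w M by (intro conv_pow_mono w_nonneg) auto
    show "0 \<le> conv_pow w m (M - j)" by (intro conv_pow_nonneg w_nonneg)
  qed
  finally show ?thesis by simp
qed

text \<open>One of the \<open>L - d\<close> sites is the reservoir and the other
  \<open>L - Suc d\<close> follow the bulk weights. The lost site changes the rate by the factor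
  \<open>1 - 1 / (L - d)\<close>, and the reservoir costs \<open>ln (lb L)\<close>; both effects
  disappear per site.\<close>

lemma ln_conv_pow_rate:
  assumes \<epsilon>: "0 < \<epsilon>"
  shows "eventually (\<lambda>L. ln (bulk_z w \<Phi>) - \<rho> * ln \<Phi> - \<epsilon>
           \<le> ln (conv_pow (v L) (L - d) (N L - c)) / real (L - d)) sequentially"
proof -
  define I where "I = ln (bulk_z w \<Phi>) - \<rho> * ln \<Phi>"
  obtain r where r: "r < \<rho>" and rate: "eventually (\<lambda>m. \<forall>M. r * real m \<le> real M \<longrightarrow>
           real m * (I - \<epsilon> / 2) \<le> ln (\<Sum>s\<le>M. conv_pow w m s)) sequentially"
    using conv_pow_partial_sum_rate[OF rho, of "\<epsilon> / 2"] \<epsilon> unfolding I_def by auto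
  have lim: "filterlim (\<lambda>L::nat. L - Suc d) at_top sequentially"
    by (rule filterlim_minus_const_nat_at_top)
  have rate': "eventually (\<lambda>L. \<forall>M. r * real (L - Suc d) \<le> real M \<longrightarrow>
           real (L - Suc d) * (I - \<epsilon> / 2) \<le> ln (\<Sum>s\<le>M. conv_pow w (L - Suc d) s)) sequentially"
    using eventually_compose_filterlim[OF rate lim] .
  have dens: "eventually (\<lambda>L. r < real (N L - c) / real (L - Suc d)) sequentially"
    using density_shift[of c "Suc d"] r by (rule order_tendstoD)
  have "(\<lambda>L. ln (lb L) / real (L - d) + (1 - 1 / (real L - real d)) * (I - \<epsilon> / 2)) \<longlonglongrightarrow> 0 + (1 - 0) * (I - \<epsilon> / 2)"
  proof (intro tendsto_intros lb_subexp_shift)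
    show "(\<lambda>L. 1 / (real L - real d)) \<longlonglongrightarrow> 0" by real_asymp
  qed
  then have "eventually (\<lambda>L. I - \<epsilon> < ln (lb L) / real (L - d) + (1 - 1 / (real L - real d)) * (I - \<epsilon> / 2)) sequentially"
    by (rule order_tendstoD) (use \<epsilon> in simp)
  then have "eventually (\<lambda>L. I - \<epsilon> \<le> ln (conv_pow (v L) (L - d) (N L - c)) / real (L - d)) sequentially"
    using rate' dens bulk_le lb_le lb_pos eventually_gt_at_top[of "Suc d"]
  proof eventually_elim
    case (elim L)
    let ?m = "L - Suc d" and ?M = "N L - c"
    let ?B = "\<Sum>s\<le>?M. conv_pow w ?m s"
    have m: "L - d = Suc ?m" "0 < ?m" using elim by auto
    have "r * real ?m \<le> real ?M" using elim(3) m by (simp add: field_simps)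
    then have B: "real ?m * (I - \<epsilon> / 2) \<le> ln ?B" using elim(2) by blast
    \<comment> \<open>Since \<open>ln\<close> is total, the lower bound on \<open>ln ?B\<close> does
      not give positivity; the empty configuration does.\<close>
    have "0 < ?B"
    proof -
      have "w 0 ^ ?m \<le> ?B"
        using member_le_sum[of 0 "{..?M}" "conv_pow w ?m"] w_nonneg
        by (auto simp: conv_pow_at_0 intro!: conv_pow_nonneg)
      then show ?thesis using zero_less_power[OF w0_pos, of ?m] by linarith
    qed
    moreover have "lb L * ?B \<le> conv_pow (v L) (L - d) ?M"
      unfolding m(1) using elim by (intro conv_pow_ge_partial_sum[of "N L"]) auto
    ultimately have "ln (lb L * ?B) \<le> ln (conv_pow (v L) (L - d) ?M)"
      using elim(6) by (intro ln_mono mult_pos_pos)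
    then have "ln (lb L) + real ?m * (I - \<epsilon> / 2) \<le> ln (conv_pow (v L) (L - d) ?M)"
      using B elim(6) \<open>0 < ?B\<close> by (simp add: ln_mult)
    then have "(ln (lb L) + real ?m * (I - \<epsilon> / 2)) / real (L - d) \<le> ln (conv_pow (v L) (L - d) ?M) / real (L - d)"
      by (intro divide_right_mono) auto
    moreover have "real ?m / real (L - d) = 1 - 1 / (real L - real d)"
      using elim(7) by (simp add: of_nat_diff field_simps)
    then have "real ?m * (I - \<epsilon> / 2) / real (L - d) = (1 - 1 / (real L - real d)) * (I - \<epsilon> / 2)"
      by (metis times_divide_eq_left)
    ultimately show ?case using elim(1) by (simp add: add_divide_distrib)
  qed
  then show ?thesis by (simp add: I_def)
qed

section \<open>Single-site and cylinder probabilities\<close>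

lemma Phi_bounds: "0 \<le> \<Phi>" "\<Phi> \<le> 1" "0 < bulk_z w \<Phi>"
  using bulk_Phi[OF rho] by (auto intro!: bulk_z_pos le_1_less_phibar)

text \<open>The bound must be evaluated strictly inside the unit interval: \<open>v_upper\<close>
  covers only fugacities below 1, and \<open>ln \<phi>\<close> needs a positive one.
  \<open>\<Phi>\<close> may be an endpoint, but it is a limit point of the interval and the
  expression tends to its value there.\<close>

lemma fugacity_near_Phi:
  assumes \<epsilon>: "0 < \<epsilon>"
  obtains \<phi> where "0 < \<phi>" "\<phi> < 1"
    "(bulk_z w \<phi> + a * (w k * \<phi> ^ k)) / bulk_z w \<Phi> - 1 - \<rho> * (ln \<phi> - ln \<Phi>)
       < a * (w k * \<Phi> ^ k / bulk_z w \<Phi>) + \<epsilon>"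
proof -
  let ?F = "at \<Phi> within {0<..<1}"
  have z: "isCont (bulk_z w) \<Phi>"
    using Phi_bounds by (intro bulk_z_isCont le_1_less_phibar)
  then have z': "(bulk_z w \<longlongrightarrow> bulk_z w \<Phi>) ?F"
    by (auto simp: isCont_def intro: tendsto_within_subset)
  \<comment> \<open>If \<open>\<Phi> = 0\<close>, then \<open>\<rho> = 0\<close>, and this factor
    removes the singularity of the logarithm.\<close>
  have ln: "((\<lambda>\<phi>. \<rho> * (ln \<phi> - ln \<Phi>)) \<longlongrightarrow> 0) ?F"
  proof (cases "\<Phi> = 0")
    case True
    then have "\<rho> = 0" using bulk_Phi(3)[OF rho] bulk_R_0 rho crit_density_pos by auto
    then show ?thesis by simp
  next
    case False
    then have "((\<lambda>\<phi>. \<rho> * (ln \<phi> - ln \<Phi>)) \<longlongrightarrow> \<rho> * (ln \<Phi> - ln \<Phi>)) ?F"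
      by (intro tendsto_intros)
    then show ?thesis by simp
  qed
  have "((\<lambda>\<phi>. (bulk_z w \<phi> + a * (w k * \<phi> ^ k)) / bulk_z w \<Phi> - 1 - \<rho> * (ln \<phi> - ln \<Phi>)) \<longlongrightarrow>
      (bulk_z w \<Phi> + a * (w k * \<Phi> ^ k)) / bulk_z w \<Phi> - 1 - 0) ?F"
    using Phi_bounds by (intro tendsto_intros z' ln) auto
  then have "eventually (\<lambda>\<phi>. (bulk_z w \<phi> + a * (w k * \<phi> ^ k)) / bulk_z w \<Phi> - 1 - \<rho> * (ln \<phi> - ln \<Phi>)
      < a * (w k * \<Phi> ^ k / bulk_z w \<Phi>) + \<epsilon>) ?F"
    by (rule order_tendstoD) (use Phi_bounds \<epsilon> in \<open>simp add: add_divide_distrib\<close>)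
  moreover have "eventually (\<lambda>\<phi>. \<phi> \<in> {0<..<1}) ?F" by (simp add: eventually_at_filter)
  ultimately have ev: "eventually (\<lambda>\<phi>. (bulk_z w \<phi> + a * (w k * \<phi> ^ k)) / bulk_z w \<Phi> - 1 - \<rho> * (ln \<phi> - ln \<Phi>)
      < a * (w k * \<Phi> ^ k / bulk_z w \<Phi>) + \<epsilon> \<and> \<phi> \<in> {0<..<1}) ?F"
    by eventually_elim auto
  have "?F \<noteq> bot"
  proof -
    consider "\<Phi> = 0" | "\<Phi> = 1" | "\<Phi> \<in> {0<..<1}" using Phi_bounds by fastforce
    then have "\<Phi> islimpt {0<..<1::real}"
    proof cases
      case 3
      then show ?thesis by (intro interior_limit_point) (simp add: interior_open)
    qed (simp_all add: islimpt_greaterThanLessThan1 islimpt_greaterThanLessThan2)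
    then show ?thesis by (simp add: trivial_limit_within)
  qed
  then show ?thesis using eventually_happens'[OF _ ev] that by auto
qed

text \<open>\<open>site_prob_upper\<close> with reference \<open>bulk_z w \<Phi>\<close> and a
  fugacity near \<open>\<Phi>\<close>; the rate bound makes the shortfall small. \<open>d\<close>
  and \<open>c\<close> count the sites already fixed and their particles.\<close>

lemma site_prob_tendsto:
  "(\<lambda>L. v L k * conv_pow (v L) (L - Suc d) (N L - c - k) / conv_pow (v L) (L - d) (N L - c))
     \<longlonglongrightarrow> w k * \<Phi> ^ k / bulk_z w \<Phi>"
proof (rule tilt_bounds_imp_tendsto)
  fix x \<epsilon> :: real assume x: "0 < x" and \<epsilon>: "0 < \<epsilon>"
  let ?q = "\<lambda>L. v L k * conv_pow (v L) (L - Suc d) (N L - c - k) / conv_pow (v L) (L - d) (N L - c)"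
  let ?z = "bulk_z w"
  obtain \<phi> where \<phi>: "0 < \<phi>" "\<phi> < 1" and near:
    "(?z \<phi> + (x - 1) * (w k * \<phi> ^ k)) / ?z \<Phi> - 1 - \<rho> * (ln \<phi> - ln \<Phi>)
       < (x - 1) * (w k * \<Phi> ^ k / ?z \<Phi>) + \<epsilon> / 2"
    using fugacity_near_Phi[of "\<epsilon> / 2" "x - 1" k] \<epsilon> by auto
  \<comment> \<open>Error budget: \<open>\<epsilon> / 2\<close> for replacing \<open>\<Phi>\<close>
    by \<open>\<phi>\<close>, \<open>\<epsilon> / 4\<close> for the two errors \<open>e\<close> in
    the generating function and the tilted term, and \<open>\<epsilon> / 8\<close> each for the
    density and the rate.\<close>
  define e where "e = \<epsilon> / 4 * min 1 (?z \<Phi> / 2)"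
  have e: "0 < e" "e \<le> \<epsilon> / 4" "2 * e / ?z \<Phi> \<le> \<epsilon> / 4"
    using \<epsilon> Phi_bounds by (auto simp: e_def min_def field_simps)
  \<comment> \<open>\<open>x - 1\<close> may be negative, so an upper bound on \<open>v L k\<close>
    alone would not do; its convergence is used.\<close>
  have "(\<lambda>L. (x - 1) * (v L k * \<phi> ^ k)) \<longlonglongrightarrow> (x - 1) * (w k * \<phi> ^ k)"
    by (intro tendsto_intros v_tendsto)
  then have ev1: "eventually (\<lambda>L. (x - 1) * (v L k * \<phi> ^ k) < (x - 1) * (w k * \<phi> ^ k) + e) sequentially"
    by (rule order_tendstoD) (use e in simp)
  have "(\<lambda>L. - (real (N L - c) / real (L - d) * ln \<phi>)) \<longlonglongrightarrow> - (\<rho> * ln \<phi>)"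
    by (intro tendsto_intros density_shift)
  then have ev2: "eventually (\<lambda>L. - (real (N L - c) / real (L - d) * ln \<phi>) < - (\<rho> * ln \<phi>) + \<epsilon> / 8) sequentially"
    by (rule order_tendstoD) (use \<epsilon> in simp)
  have ev3: "eventually (\<lambda>L. c + k \<le> N L) sequentially"
    using N_at_top by (simp add: filterlim_at_top)
  have ev4: "eventually (\<lambda>L. ln (?z \<Phi>) - \<rho> * ln \<Phi> - \<epsilon> / 8
      \<le> ln (conv_pow (v L) (L - d) (N L - c)) / real (L - d)) sequentially"
    using \<epsilon> by (intro ln_conv_pow_rate) simp
  show "eventually (\<lambda>L. ?q L * ln x \<le> (x - 1) * (w k * \<Phi> ^ k / ?z \<Phi>) + \<epsilon>) sequentially"
    using ev1 ev2 ev3 ev4 v_upper[OF \<phi> e(1)] eventually_gt_at_top[of "Suc d"]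
  proof eventually_elim
    case (elim L)
    let ?M = "N L - c" and ?m = "L - d"
    let ?S = "\<Sum>j\<le>?M. v L j * \<phi> ^ j"
    have vp: "0 < v L j" for j using v_pos elim by simp
    have S: "?S \<le> (\<Sum>j\<le>N L. v L j * \<phi> ^ j)"
      using vp \<phi> by (intro sum_mono2) (auto intro!: mult_nonneg_nonneg less_imp_le[OF vp])
    have "?q L * ln x \<le> (?S + (x - 1) * (v L k * \<phi> ^ k)) / ?z \<Phi> - 1
        + (ln (?z \<Phi>) - real ?M / real ?m * ln \<phi> - ln (conv_pow (v L) ?m ?M) / real ?m)"
      using site_prob_upper[of "v L" x \<phi> ?m k ?M "?z \<Phi>"] vp x \<phi> elim Phi_bounds by simp
    moreover have "(?S + (x - 1) * (v L k * \<phi> ^ k)) / ?z \<Phi>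
        \<le> (?z \<phi> + (x - 1) * (w k * \<phi> ^ k) + 2 * e) / ?z \<Phi>"
      using S elim Phi_bounds by (intro divide_right_mono) auto
    then have "(?S + (x - 1) * (v L k * \<phi> ^ k)) / ?z \<Phi>
        \<le> (?z \<phi> + (x - 1) * (w k * \<phi> ^ k)) / ?z \<Phi> + 2 * e / ?z \<Phi>"
      by (simp add: add_divide_distrib)
    ultimately show ?case using near elim e unfolding right_diff_distrib[of \<rho>] by linarith
  qed
qed

text \<open>Chain rule: each inserted site multiplies by the conditional probability of its value
  given the sites fixed before, which is the quotient in \<open>site_prob_tendsto\<close> with
  \<open>card D\<close> sites and \<open>sum k D\<close> particles removed.\<close>

lemma cylinder_prob_tendsto:
  assumes "finite D"
  shows "(\<lambda>L. (\<Prod>x\<in>D. v L (k x)) * conv_pow (v L) (L - card D) (N L - (\<Sum>x\<in>D. k x))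
            / conv_pow (v L) L (N L))
     \<longlonglongrightarrow> (\<Prod>x\<in>D. w (k x) * \<Phi> ^ k x / bulk_z w \<Phi>)"
  using assms
proof (induction D)
  case empty
  have "eventually (\<lambda>L. conv_pow (v L) L (N L) / conv_pow (v L) L (N L) = 1) sequentially"
    using eventually_gt_at_top[of 0]
  proof eventually_elim
    case (elim L)
    then have "0 < conv_pow (v L) L (N L)" using v_pos by (intro conv_pow_pos) auto
    then show ?case by simp
  qed
  then show ?case by (simp add: tendsto_eventually)
next
  case (insert y D)
  let ?p = "\<lambda>D. \<lambda>L. (\<Prod>x\<in>D. v L (k x)) * conv_pow (v L) (L - card D) (N L - (\<Sum>x\<in>D. k x)) / conv_pow (v L) L (N L)"
  let ?q = "\<lambda>L. v L (k y) * conv_pow (v L) (L - Suc (card D)) (N L - (\<Sum>x\<in>D. k x) - k y)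
      / conv_pow (v L) (L - card D) (N L - (\<Sum>x\<in>D. k x))"
  have "(\<lambda>L. ?q L * ?p D L) \<longlonglongrightarrow> (w (k y) * \<Phi> ^ k y / bulk_z w \<Phi>) * (\<Prod>x\<in>D. w (k x) * \<Phi> ^ k x / bulk_z w \<Phi>)"
    by (intro tendsto_mult insert.IH site_prob_tendsto)
  moreover have "eventually (\<lambda>L. ?q L * ?p D L = ?p (insert y D) L) sequentially"
    using eventually_gt_at_top[of "card D"]
  proof eventually_elim
    case (elim L)
    then have "0 < conv_pow (v L) (L - card D) (N L - (\<Sum>x\<in>D. k x))"
      using v_pos by (intro conv_pow_pos) auto
    then show ?case using insert.hyps by (simp add: add.commute)
  qed
  ultimately have "?p (insert y D) \<longlonglongrightarrow> (w (k y) * \<Phi> ^ k y / bulk_z w \<Phi>) * (\<Prod>x\<in>D. w (k x) * \<Phi> ^ k x / bulk_z w \<Phi>)"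
    by (rule Lim_transform_eventually)
  moreover have "(\<Prod>x\<in>insert y D. w (k x) * \<Phi> ^ k x / bulk_z w \<Phi>)
      = (w (k y) * \<Phi> ^ k y / bulk_z w \<Phi>) * (\<Prod>x\<in>D. w (k x) * \<Phi> ^ k x / bulk_z w \<Phi>)"
    by (rule prod.insert[OF insert.hyps])
  ultimately show ?case by (simp only:)
qed

end

section \<open>Canonical and bulk measures\<close>

lemma prob_space_eq_point_measure:
  assumes "prob_space M" "sets M = Pow E" "countable E"
  shows "M = point_measure E (\<lambda>x. ennreal (measure M {x}))"
proof (rule measure_eqI_countable[OF assms(2) _ assms(3)])
  interpret prob_space M by fact
  fix a assume "a \<in> E"
  then show "emeasure M {a} = emeasure (point_measure E (\<lambda>x. ennreal (measure M {x}))) {a}"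
    by (simp add: emeasure_point_measure_finite2 emeasure_eq_measure)
qed (simp add: sets_point_measure)

text \<open>Scheffe: the singleton masses are densities for counting measure with total mass 1, so
  their pointwise convergence is convergence in L1, which suffices for bounded
  \<open>f\<close>.\<close>

lemma integral_tendsto_if_singletons_tendsto:
  fixes f :: "'b \<Rightarrow> real"
  assumes E: "countable E"
    and M: "\<And>n. prob_space (M n)" "\<And>n. sets (M n) = Pow E"
    and M': "prob_space M'" "sets M' = Pow E"
    and lim: "\<And>x. x \<in> E \<Longrightarrow> (\<lambda>n. measure (M n) {x}) \<longlonglongrightarrow> measure M' {x}"
    and bd: "\<And>x. x \<in> E \<Longrightarrow> \<bar>f x\<bar> \<le> C"
  shows "(\<lambda>n. \<integral>x. f x \<partial>M n) \<longlonglongrightarrow> (\<integral>x. f x \<partial>M')"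
proof -
  let ?c = "count_space E"
  have mass: "(\<integral>\<^sup>+x. norm (measure N {x}) \<partial>?c) = 1" "integrable ?c (\<lambda>x. measure N {x})"
      "integral\<^sup>L N f = (\<integral>x. measure N {x} * f x \<partial>?c)"
      "integrable ?c (\<lambda>x. measure N {x} * f x)"
    if N: "prob_space N" "sets N = Pow E" for N
  proof -
    interpret prob_space N by (rule N)
    have sp: "space N = E" using N(2) by (metis sets_eq_imp_space_eq sets_count_space space_count_space)
    note dens = prob_space_eq_point_measure[OF N E, unfolded point_measure_def]
    have "emeasure N E = (\<integral>\<^sup>+x. norm (measure N {x}) \<partial>?c)"
      by (subst dens) (auto simp: emeasure_density intro!: nn_integral_cong)
    then show 1: "(\<integral>\<^sup>+x. norm (measure N {x}) \<partial>?c) = 1"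
      using emeasure_space_1 sp by simp
    then show int: "integrable ?c (\<lambda>x. measure N {x})"
      by (simp add: integrable_iff_bounded)
    show "integral\<^sup>L N f = (\<integral>x. measure N {x} * f x \<partial>?c)"
      by (subst dens) (simp add: integral_density)
    show "integrable ?c (\<lambda>x. measure N {x} * f x)"
    proof (rule Bochner_Integration.integrable_bound)
      show "integrable ?c (\<lambda>x. C * measure N {x})" using int by simp
      show "AE x in ?c. norm (measure N {x} * f x) \<le> norm (C * measure N {x})"
        using bd by (auto simp: AE_count_space abs_mult mult.commute[of "measure N _"] intro!: mult_right_mono order_trans[OF bd])
    qed simp
  qed
  let ?d = "\<lambda>n x. measure (M n) {x} - measure M' {x}"
  have "(\<lambda>n. \<integral>\<^sup>+x. norm (?d n x) \<partial>?c) \<longlonglongrightarrow> 0"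
    using mass M M' lim by (intro Scheffe_lemma2) (auto simp: AE_count_space)
  moreover have int_d: "integrable ?c (?d n)" for n
    using mass M M' by (intro Bochner_Integration.integrable_diff) auto
  then have "(\<integral>\<^sup>+x. norm (?d n x) \<partial>?c) = ennreal (\<integral>x. \<bar>?d n x\<bar> \<partial>?c)" for n
    using nn_integral_eq_integral[of ?c "\<lambda>x. \<bar>?d n x\<bar>"] integrable_abs[OF int_d[of n]] by simp
  ultimately have "(\<lambda>n. ennreal (\<integral>x. \<bar>?d n x\<bar> \<partial>?c)) \<longlonglongrightarrow> ennreal 0" by simp
  then have L1: "(\<lambda>n. \<integral>x. \<bar>?d n x\<bar> \<partial>?c) \<longlonglongrightarrow> 0"
    by (subst (asm) tendsto_ennreal_iff) auto
  have bound: "\<bar>(\<integral>x. f x \<partial>M n) - (\<integral>x. f x \<partial>M')\<bar> \<le> C * (\<integral>x. \<bar>?d n x\<bar> \<partial>?c)" for n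
  proof -
    have "(\<integral>x. f x \<partial>M n) - (\<integral>x. f x \<partial>M') = (\<integral>x. ?d n x * f x \<partial>?c)"
      using mass M M' by (simp add: left_diff_distrib)
    also have "\<bar>\<dots>\<bar> \<le> (\<integral>x. \<bar>?d n x * f x\<bar> \<partial>?c)" by (rule integral_abs_bound)
    also have "\<dots> \<le> (\<integral>x. C * \<bar>?d n x\<bar> \<partial>?c)"
    proof (rule integral_mono)
      have "integrable ?c (\<lambda>x. measure (M n) {x} * f x - measure M' {x} * f x)"
        using mass M M' by (intro Bochner_Integration.integrable_diff) auto
      then show "integrable ?c (\<lambda>x. \<bar>?d n x * f x\<bar>)" by (simp add: left_diff_distrib)
      show "integrable ?c (\<lambda>x. C * \<bar>?d n x\<bar>)" using int_d[of n] by simp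
      show "\<bar>?d n x * f x\<bar> \<le> C * \<bar>?d n x\<bar>" if "x \<in> space ?c" for x
        using bd[of x] that by (simp add: abs_mult mult.commute[of "\<bar>?d n x\<bar>"] mult_right_mono)
    qed
    finally show ?thesis by simp
  qed
  have "(\<lambda>n. (\<integral>x. f x \<partial>M n) - (\<integral>x. f x \<partial>M')) \<longlonglongrightarrow> 0"
  proof (rule tendsto_rabs_zero_cancel, rule tendsto_sandwich[OF _ _ tendsto_const])
    show "(\<lambda>n. C * (\<integral>x. \<bar>?d n x\<bar> \<partial>?c)) \<longlonglongrightarrow> 0" using tendsto_mult_left[OF L1, of C] by simp
  qed (use bound in auto)
  then show ?thesis by (rule LIM_zero_cancel)
qed

section \<open>Canonical measures through convolution powers\<close>

lemma finite_configs: "finite S \<Longrightarrow> finite (configs S N)"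
proof (rule finite_subset)
  assume S: "finite S"
  show "configs S N \<subseteq> S \<rightarrow>\<^sub>E {..N}"
  proof
    fix \<eta> assume "\<eta> \<in> configs S N"
    then show "\<eta> \<in> S \<rightarrow>\<^sub>E {..N}"
      using member_le_sum[of _ S \<eta>] S by (auto simp: configs_def PiE_iff)
  qed
qed (auto intro: finite_PiE)

text \<open>Configurations with prescribed values on \<open>D\<close> correspond to configurations
  outside \<open>D\<close>, and the product weight factorizes. A single site gives the recursion of
  the partition function; a general \<open>D\<close> gives the cylinder probabilities.\<close>

lemma sum_configs_restrict:
  assumes S: "finite S" "D \<subseteq> S" and k: "k \<in> D \<rightarrow>\<^sub>E UNIV" "sum k D \<le> N"
  shows "(\<Sum>\<eta> | \<eta> \<in> configs S N \<and> restrict \<eta> D = k. \<Prod>x\<in>S. v (\<eta> x))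
    = (\<Prod>x\<in>D. v (k x)) * partition_fun v (S - D) (N - sum k D)"
proof -
  have D: "finite D" using S finite_subset by blast
  have split: "sum g S = sum g D + sum g (S - D)" for g :: "'a \<Rightarrow> nat"
    using S by (metis sum.subset_diff add.commute)
  have psplit: "prod g S = prod g D * prod g (S - D)" for g :: "'a \<Rightarrow> real"
    using S by (metis prod.subset_diff mult.commute)
  have "(\<Sum>\<eta> | \<eta> \<in> configs S N \<and> restrict \<eta> D = k. \<Prod>x\<in>S. v (\<eta> x))
      = (\<Sum>\<xi>\<in>configs (S - D) (N - sum k D). (\<Prod>x\<in>D. v (k x)) * (\<Prod>x\<in>S - D. v (\<xi> x)))"
  proof (rule sum.reindex_bij_witness[where i = "\<lambda>\<xi> x. if x \<in> D then k x else \<xi> x"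
        and j = "\<lambda>\<eta>. restrict \<eta> (S - D)"])
    let ?i = "\<lambda>\<eta>. restrict \<eta> (S - D)"
    let ?j = "\<lambda>\<xi> x. if x \<in> D then k x else \<xi> x"
    fix \<eta> assume "\<eta> \<in> {\<eta> \<in> configs S N. restrict \<eta> D = k}"
    then have \<eta>: "\<eta> \<in> S \<rightarrow>\<^sub>E UNIV" "sum \<eta> S = N" "\<And>x. x \<in> D \<Longrightarrow> \<eta> x = k x"
      by (auto simp: configs_def)
    show "?j (?i \<eta>) = \<eta>" using \<eta> S by (auto simp: fun_eq_iff PiE_iff extensional_def)
    show "?i \<eta> \<in> configs (S - D) (N - sum k D)"
      using \<eta> split[of \<eta>] by (auto simp: configs_def)
    show "(\<Prod>x\<in>D. v (k x)) * (\<Prod>x\<in>S - D. v (?i \<eta> x)) = (\<Prod>x\<in>S. v (\<eta> x))"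
      using \<eta> by (simp add: psplit)
  next
    let ?i = "\<lambda>\<eta>. restrict \<eta> (S - D)"
    let ?j = "\<lambda>\<xi> x. if x \<in> D then k x else \<xi> x"
    fix \<xi> assume "\<xi> \<in> configs (S - D) (N - sum k D)"
    then have \<xi>: "\<xi> \<in> (S - D) \<rightarrow>\<^sub>E UNIV" "sum \<xi> (S - D) = N - sum k D" by (auto simp: configs_def)
    show "?i (?j \<xi>) = \<xi>" using \<xi> by (auto simp: fun_eq_iff PiE_iff extensional_def)
    have "sum (?j \<xi>) S = N" using \<xi> k by (simp add: split)
    moreover have "?j \<xi> \<in> S \<rightarrow>\<^sub>E UNIV" using \<xi> S by (auto simp: PiE_iff extensional_def)
    moreover have "restrict (?j \<xi>) D = k" using k by (auto simp: fun_eq_iff PiE_iff extensional_def)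
    ultimately show "?j \<xi> \<in> {\<eta> \<in> configs S N. restrict \<eta> D = k}" by (simp add: configs_def)
  qed
  then show ?thesis by (simp add: partition_fun_def sum_distrib_left)
qed

lemma partition_fun_eq_conv_pow:
  assumes "finite S"
  shows "partition_fun v S N = conv_pow v (card S) N"
  using assms
proof (induction S arbitrary: N)
  case empty
  \<comment> \<open>The only extensional function on the empty set is constantly
    \<open>undefined\<close>; it accounts for the base value 1 of \<open>conv_pow\<close>.\<close>
  have "configs {} N = (if N = 0 then {\<lambda>_. undefined} else {})" by (auto simp: configs_def)
  show ?case unfolding partition_fun_def \<open>configs {} N = _\<close> by simp
next
  case (insert x S)
  let ?C = "configs (insert x S) N"
  have fin: "finite ?C" using insert.hyps by (intro finite_configs) auto
  have le: "(\<lambda>\<eta>. \<eta> x) ` ?C \<subseteq> {..N}"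
    using insert.hyps by (auto simp: configs_def)
  have "partition_fun v (insert x S) N = (\<Sum>j\<le>N. \<Sum>\<eta> | \<eta> \<in> ?C \<and> \<eta> x = j. \<Prod>y\<in>insert x S. v (\<eta> y))"
    unfolding partition_fun_def by (rule sum.group[OF fin _ le, symmetric]) simp
  also have "\<dots> = (\<Sum>j\<le>N. v j * partition_fun v S (N - j))"
  proof (rule sum.cong[OF refl])
    fix j assume j: "j \<in> {..N}"
    have "{\<eta> \<in> ?C. \<eta> x = j} = {\<eta> \<in> ?C. restrict \<eta> {x} = (\<lambda>y\<in>{x}. j)}"
      by (auto simp: fun_eq_iff)
    then show "(\<Sum>\<eta> | \<eta> \<in> ?C \<and> \<eta> x = j. \<Prod>y\<in>insert x S. v (\<eta> y)) = v j * partition_fun v S (N - j)"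
      using sum_configs_restrict[of "insert x S" "{x}" "\<lambda>y\<in>{x}. j" N v] insert.hyps j by simp
  qed
  also have "\<dots> = conv_pow v (card (insert x S)) N" using insert by simp
  finally show ?case .
qed

text \<open>Nonempty \<open>S\<close> makes the normalization positive for every \<open>N\<close>,
  as one site can hold all particles; on the empty set there is no configuration with
  \<open>N > 0\<close>.\<close>

lemma canonical_measure:
  assumes "finite S" and v: "\<And>n. 0 < v n" and "S \<noteq> {}"
  shows prob_space_canonical_measure: "prob_space (canonical_measure v S N)"
    and measure_canonical_measure: "X \<subseteq> configs S N \<Longrightarrow>
      measure (canonical_measure v S N) X = (\<Sum>\<eta>\<in>X. \<Prod>x\<in>S. v (\<eta> x)) / partition_fun v S N"
proof -
  let ?p = "\<lambda>\<eta>. (\<Prod>x\<in>S. v (\<eta> x)) / partition_fun v S N"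
  have fin: "finite (configs S N)" using assms(1) by (rule finite_configs)
  have Z: "0 < partition_fun v S N"
    using assms by (simp add: partition_fun_eq_conv_pow conv_pow_pos card_gt_0_iff)
  have p: "0 \<le> ?p \<eta>" for \<eta>
    using Z v by (intro divide_nonneg_nonneg prod_nonneg) (auto intro: less_imp_le)
  have em: "emeasure (canonical_measure v S N) X = ennreal ((\<Sum>\<eta>\<in>X. \<Prod>x\<in>S. v (\<eta> x)) / partition_fun v S N)"
    if "X \<subseteq> configs S N" for X
    unfolding canonical_measure_def sum_divide_distrib
    using that fin p by (simp add: emeasure_point_measure_finite sum_ennreal)
  show "prob_space (canonical_measure v S N)"
  proof
    have "space (canonical_measure v S N) = configs S N"
      by (simp add: canonical_measure_def space_point_measure)
    then show "emeasure (canonical_measure v S N) (space (canonical_measure v S N)) = 1"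
      using Z by (simp add: em partition_fun_def[symmetric])
  qed
  show "measure (canonical_measure v S N) X = (\<Sum>\<eta>\<in>X. \<Prod>x\<in>S. v (\<eta> x)) / partition_fun v S N"
    if "X \<subseteq> configs S N"
    using that p unfolding measure_def em[OF that] sum_divide_distrib
    by (simp add: sum_nonneg)
qed

lemma marginal_canonical_measure:
  assumes S: "finite S" "S \<noteq> {}" "D \<subseteq> S" and v: "\<And>n. 0 < v n"
  shows prob_space_marginal: "prob_space (marginal D (canonical_measure v S N))"
    and measure_marginal_singleton: "k \<in> D \<rightarrow>\<^sub>E UNIV \<Longrightarrow> sum k D \<le> N \<Longrightarrow>
      measure (marginal D (canonical_measure v S N)) {k}
        = (\<Prod>x\<in>D. v (k x)) * conv_pow v (card S - card D) (N - sum k D) / conv_pow v (card S) N"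
proof -
  let ?M = "canonical_measure v S N"
  have D: "finite D" using S finite_subset by blast
  \<comment> \<open>For finite \<open>D\<close> the product sigma-algebra is the full power set, so
    singletons and restriction are measurable.\<close>
  have P: "PiM D (\<lambda>_. count_space (UNIV :: nat set)) = count_space (D \<rightarrow>\<^sub>E UNIV)"
    using D by (intro count_space_PiM_finite) auto
  have sp: "space ?M = configs S N"
    by (simp add: canonical_measure_def space_point_measure)
  have meas: "(\<lambda>\<eta>. restrict \<eta> D) \<in> measurable ?M (PiM D (\<lambda>_. count_space UNIV))"
    unfolding P canonical_measure_def by auto
  interpret prob_space ?M using S v by (intro prob_space_canonical_measure)
  show "prob_space (marginal D ?M)"
    unfolding marginal_def using meas by (rule prob_space_distr)
  assume k: "k \<in> D \<rightarrow>\<^sub>E UNIV" "sum k D \<le> N"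
  have "measure (marginal D ?M) {k} = measure ?M {\<eta> \<in> configs S N. restrict \<eta> D = k}"
    unfolding marginal_def using meas k
    by (subst measure_distr) (auto simp: P sp intro!: arg_cong[where f = "measure ?M"])
  also have "\<dots> = (\<Sum>\<eta> | \<eta> \<in> configs S N \<and> restrict \<eta> D = k. \<Prod>x\<in>S. v (\<eta> x)) / partition_fun v S N"
    using S v by (intro measure_canonical_measure) auto
  also have "\<dots> = (\<Prod>x\<in>D. v (k x)) * conv_pow v (card S - card D) (N - sum k D) / conv_pow v (card S) N"
    using S D k by (simp add: sum_configs_restrict partition_fun_eq_conv_pow card_Diff_subset)
  finally show "measure (marginal D ?M) {k} = \<dots>" .
qed

lemma sets_marginal:
  assumes "finite D"
  shows "sets (marginal D M) = Pow (D \<rightarrow>\<^sub>E UNIV)"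
proof -
  have "PiM D (\<lambda>_. count_space (UNIV :: nat set)) = count_space (D \<rightarrow>\<^sub>E UNIV)"
    using assms by (intro count_space_PiM_finite) auto
  then show ?thesis by (simp add: marginal_def)
qed

section \<open>Bulk product measures on finite site sets\<close>

context bulk_weights
begin

lemma bulk_site:
  assumes "0 \<le> \<phi>" "ereal \<phi> < \<phi>bar"
  shows prob_space_bulk_site: "prob_space (bulk_site w \<phi>)"
    and emeasure_bulk_site: "emeasure (bulk_site w \<phi>) {n} = ennreal (w n * \<phi> ^ n / bulk_z w \<phi>)"
proof -
  have z: "0 < bulk_z w \<phi>" using assms by (rule bulk_z_pos)
  have sums: "(\<lambda>n. w n * \<phi> ^ n / bulk_z w \<phi>) sums 1"
    using sums_divide[OF bulk_z_sums[OF assms], of "bulk_z w \<phi>"] z by simp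
  have nn: "0 \<le> w n * \<phi> ^ n / bulk_z w \<phi>" for n using z assms w_nonneg by simp
  show "prob_space (bulk_site w \<phi>)"
  proof
    have "emeasure (bulk_site w \<phi>) UNIV = (\<integral>\<^sup>+n. ennreal (w n * \<phi> ^ n / bulk_z w \<phi>) \<partial>count_space UNIV)"
      by (simp add: bulk_site_def point_measure_def emeasure_density)
    also have "\<dots> = (\<Sum>n. ennreal (w n * \<phi> ^ n / bulk_z w \<phi>))" by (rule nn_integral_count_space_nat)
    also have "\<dots> = 1" using suminf_ennreal_eq[OF nn sums] by simp
    finally show "emeasure (bulk_site w \<phi>) (space (bulk_site w \<phi>)) = 1"
      by (simp add: bulk_site_def space_point_measure)
  qed
  show "emeasure (bulk_site w \<phi>) {n} = ennreal (w n * \<phi> ^ n / bulk_z w \<phi>)"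
    by (simp add: bulk_site_def emeasure_point_measure_finite2)
qed

lemma bulk_measure:
  assumes "0 \<le> \<phi>" "ereal \<phi> < \<phi>bar" and D: "finite D"
  shows prob_space_bulk_measure: "prob_space (bulk_measure w \<phi> D)"
    and sets_bulk_measure: "sets (bulk_measure w \<phi> D) = Pow (D \<rightarrow>\<^sub>E UNIV)"
    and measure_bulk_measure: "k \<in> D \<rightarrow>\<^sub>E UNIV \<Longrightarrow>
      measure (bulk_measure w \<phi> D) {k} = (\<Prod>x\<in>D. w (k x) * \<phi> ^ k x / bulk_z w \<phi>)"
proof -
  have z: "0 < bulk_z w \<phi>" using assms(1,2) by (rule bulk_z_pos)
  show "prob_space (bulk_measure w \<phi> D)"
    unfolding bulk_measure_def using assms by (intro prob_space_PiM prob_space_bulk_site)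
  have "sets (bulk_measure w \<phi> D) = sets (PiM D (\<lambda>_. count_space (UNIV :: nat set)))"
    unfolding bulk_measure_def by (intro sets_PiM_cong) (simp_all add: bulk_site_def sets_point_measure)
  also have "PiM D (\<lambda>_. count_space (UNIV :: nat set)) = count_space (D \<rightarrow>\<^sub>E UNIV)"
    using D by (intro count_space_PiM_finite) auto
  finally show "sets (bulk_measure w \<phi> D) = Pow (D \<rightarrow>\<^sub>E UNIV)" by simp
  assume k: "k \<in> D \<rightarrow>\<^sub>E UNIV"
  interpret prob_space "bulk_site w \<phi>" using assms(1,2) by (rule prob_space_bulk_site)
  interpret product_sigma_finite "\<lambda>_. bulk_site w \<phi>" by standard
  \<comment> \<open>A singleton is a box with one-point sides, so the product formula
    applies.\<close>
  have "emeasure (bulk_measure w \<phi> D) (\<Pi>\<^sub>E x\<in>D. {k x}) = (\<Prod>x\<in>D. ennreal (w (k x) * \<phi> ^ k x / bulk_z w \<phi>))"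
    unfolding bulk_measure_def using D assms(1,2)
    by (subst emeasure_PiM) (simp_all add: emeasure_bulk_site, simp add: bulk_site_def sets_point_measure)
  also have "(\<Pi>\<^sub>E x\<in>D. {k x}) = {k}" using k by (intro PiE_singleton) (auto simp: PiE_def)
  also have "(\<Prod>x\<in>D. ennreal (w (k x) * \<phi> ^ k x / bulk_z w \<phi>)) = ennreal (\<Prod>x\<in>D. w (k x) * \<phi> ^ k x / bulk_z w \<phi>)"
    using z assms w_nonneg by (intro prod_ennreal) simp
  finally show "measure (bulk_measure w \<phi> D) {k} = (\<Prod>x\<in>D. w (k x) * \<phi> ^ k x / bulk_z w \<phi>)"
    using z assms w_nonneg by (simp add: measure_def prod_nonneg)
qed

end

text \<open>The state space is countable, so convergence of cylinder probabilities for full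
  configurations on \<open>D\<close> already controls all bounded test functions.\<close>

lemma (in thermodynamic_limit) marginals_converge:
  assumes sites: "\<And>L. finite (\<Lambda> L)" "\<And>L. card (\<Lambda> L) = L"
    and D: "finite D" "eventually (\<lambda>L. D \<subseteq> \<Lambda> L) sequentially"
  shows "converges_in_distribution (config_topology D)
    (\<lambda>L. marginal D (canonical_measure (v L) (\<Lambda> L) (N L))) (bulk_measure w \<Phi> D)"
  unfolding converges_in_distribution_def
proof (intro allI impI)
  fix f assume f: "continuous_map (config_topology D) euclideanreal f \<and> bounded (f ` topspace (config_topology D))"
  let ?E = "D \<rightarrow>\<^sub>E (UNIV :: nat set)"
  let ?M = "\<lambda>L. marginal D (canonical_measure (v L) (\<Lambda> L) (N L))"
  have \<Phi>: "0 \<le> \<Phi>" "ereal \<Phi> < \<phi>bar" using Phi_bounds le_1_less_phibar by auto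
  have "topspace (config_topology D) = ?E" by (simp add: config_topology_def)
  then obtain C where "\<forall>y\<in>f ` ?E. norm y \<le> C"
    using f unfolding bounded_iff by auto
  then have C: "\<bar>f k\<bar> \<le> C" if "k \<in> ?E" for k using that by auto
  \<comment> \<open>Before \<open>L0\<close> the sites may be none or may not contain
    \<open>D\<close>, and the marginal need not be a probability measure; the sequence is shifted by
    \<open>L0\<close>, and \<open>1 \<le> L0\<close> makes \<open>v_pos\<close> available.\<close>
  obtain L0 where L0: "\<And>L. L0 \<le> L \<Longrightarrow> D \<subseteq> \<Lambda> L" "1 \<le> L0"
    using D(2) unfolding eventually_sequentially by (metis le_max_iff_disj max.cobounded1 nat_le_linear le_trans max.boundedE)
  have S: "finite (\<Lambda> L)" "\<Lambda> L \<noteq> {}" "D \<subseteq> \<Lambda> L" "0 < v L n" if "L0 \<le> L" for L n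
    using that L0(1)[OF that] L0(2) sites[of L] v_pos[of L] by auto
  have "(\<lambda>n. \<integral>k. f k \<partial>?M (n + L0)) \<longlonglongrightarrow> (\<integral>k. f k \<partial>bulk_measure w \<Phi> D)"
  proof (rule integral_tendsto_if_singletons_tendsto)
    show "countable ?E" using D(1) by (intro countable_PiE) auto
    show "prob_space (?M (n + L0))" for n using S[of "n + L0"] by (intro prob_space_marginal) auto
    show "sets (?M (n + L0)) = Pow ?E" for n using D(1) by (rule sets_marginal)
    show "prob_space (bulk_measure w \<Phi> D)" using \<Phi> D(1) by (rule prob_space_bulk_measure)
    show "sets (bulk_measure w \<Phi> D) = Pow ?E" using \<Phi> D(1) by (rule sets_bulk_measure)
    show "\<bar>f k\<bar> \<le> C" if "k \<in> ?E" for k using C that by blast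
    fix k assume k: "k \<in> ?E"
    have "eventually (\<lambda>L. sum k D \<le> N L) sequentially"
      using N_at_top by (simp add: filterlim_at_top)
    then have "eventually (\<lambda>L. (\<Prod>x\<in>D. v L (k x)) * conv_pow (v L) (L - card D) (N L - sum k D) / conv_pow (v L) L (N L)
        = measure (?M L) {k}) sequentially"
      using eventually_ge_at_top[of L0]
    proof eventually_elim
      case (elim L)
      then show ?case
        using measure_marginal_singleton[of "\<Lambda> L" D "v L" k "N L"] S k sites(2)[of L] by simp
    qed
    then have "(\<lambda>L. measure (?M L) {k}) \<longlonglongrightarrow> measure (bulk_measure w \<Phi> D) {k}"
      using cylinder_prob_tendsto[OF D(1), of k] measure_bulk_measure[OF \<Phi> D(1) k]
      by (simp add: Lim_transform_eventually)
    then show "(\<lambda>n. measure (?M (n + L0)) {k}) \<longlonglongrightarrow> measure (bulk_measure w \<Phi> D) {k}"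
      by (rule LIMSEQ_ignore_initial_segment)
  qed
  then show "(\<lambda>L. \<integral>k. f k \<partial>?M L) \<longlonglongrightarrow> (\<integral>k. f k \<partial>bulk_measure w \<Phi> D)"
    by (rule LIMSEQ_offset)
qed

section \<open>Perturbed weights\<close>

lemma summable_powr_times_power:
  fixes \<kappa> \<phi> :: real
  assumes "0 < \<phi>" "\<phi> < 1"
  shows "summable (\<lambda>n. (real n + 1) powr \<kappa> * \<phi> ^ n)"
proof (rule summable_comparison_test_bigo)
  show "summable (\<lambda>n. norm (1 / real n ^ 2))"
    using inverse_power_summable[of 2, where 'a = real] by (simp add: inverse_eq_divide)
  show "(\<lambda>n. (real n + 1) powr \<kappa> * \<phi> ^ n) \<in> O(\<lambda>n. 1 / real n ^ 2)"
    using assms by real_asymp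
qed

lemma perturbed_weight_bounds:
  assumes \<delta>: "\<And>n. n \<le> M \<Longrightarrow> \<bar>\<delta> L n\<bar> \<le> 1 / 2" and "0 \<le> \<theta>" and n: "n \<le> M"
  shows "w n + \<theta> / 2 / real L powr \<gamma> * (real n + 1) powr \<kappa> \<le> perturbed_weight w \<theta> \<gamma> \<kappa> \<delta> L n"
    and "perturbed_weight w \<theta> \<gamma> \<kappa> \<delta> L n \<le> w n + 3 * \<theta> / 2 / real L powr \<gamma> * (real n + 1) powr \<kappa>"
proof -
  let ?a = "\<theta> / real L powr \<gamma> * (real n + 1) powr \<kappa>"
  have a: "0 \<le> ?a" using \<open>0 \<le> \<theta>\<close> by simp
  have "1 / 2 \<le> 1 + \<delta> L n" "1 + \<delta> L n \<le> 3 / 2"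
    using \<delta>[OF n] by linarith+
  from this[THEN mult_left_mono, OF a]
  have "?a * (1 / 2) \<le> ?a * (1 + \<delta> L n)" "?a * (1 + \<delta> L n) \<le> ?a * (3 / 2)" .
  then show "w n + \<theta> / 2 / real L powr \<gamma> * (real n + 1) powr \<kappa> \<le> perturbed_weight w \<theta> \<gamma> \<kappa> \<delta> L n"
    and "perturbed_weight w \<theta> \<gamma> \<kappa> \<delta> L n \<le> w n + 3 * \<theta> / 2 / real L powr \<gamma> * (real n + 1) powr \<kappa>"
    by (simp_all add: perturbed_weight_def)
qed

text \<open>Once \<open>L \<ge> 1\<close>, the factor \<open>L\<close> only enlarges the supremum.
  The value 1/2 keeps the perturbation within fixed positive multiples of its unperturbed
  size.\<close>

lemma eventually_delta_le_half:
  fixes \<delta> :: "nat \<Rightarrow> nat \<Rightarrow> real"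
  assumes "(\<lambda>L. real L * (SUP n\<in>{..N L}. \<bar>\<delta> L n\<bar>)) \<longlonglongrightarrow> 0"
  shows "eventually (\<lambda>L. \<forall>n\<le>N L. \<bar>\<delta> L n\<bar> \<le> 1 / 2) sequentially"
proof -
  have "eventually (\<lambda>L. real L * (SUP n\<in>{..N L}. \<bar>\<delta> L n\<bar>) < 1 / 2) sequentially"
    by (rule order_tendstoD(2)[OF assms]) simp
  then show ?thesis using eventually_ge_at_top[of 1]
  proof eventually_elim
    case (elim L)
    show ?case
    proof (intro allI impI)
      fix n assume "n \<le> N L"
      then have le: "\<bar>\<delta> L n\<bar> \<le> (SUP n\<in>{..N L}. \<bar>\<delta> L n\<bar>)"
        by (intro cSUP_upper) auto
      also have "\<dots> \<le> real L * (SUP n\<in>{..N L}. \<bar>\<delta> L n\<bar>)"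
        using elim(2) order_trans[OF abs_ge_zero le] mult_right_mono[of 1 "real L" "SUP n\<in>{..N L}. \<bar>\<delta> L n\<bar>"] by simp
      finally show "\<bar>\<delta> L n\<bar> \<le> 1 / 2" using elim(1) by linarith
    qed
  qed
qed

lemma ln_Suc_over_tendsto_0:
  assumes "(\<lambda>L. real (N L) / real L) \<longlonglongrightarrow> \<rho>"
  shows "(\<lambda>L. ln (real (N L) + 1) / real L) \<longlonglongrightarrow> 0"
proof (rule tendsto_sandwich[OF _ _ tendsto_const])
  \<comment> \<open>\<open>N L\<close> is eventually below
    \<open>(\<bar>\<rho>\<bar> + 1) * L\<close>; one more multiple of \<open>L\<close> absorbs the
    summand 1.\<close>
  define C where "C = \<bar>\<rho>\<bar> + 2"
  have "0 < C" by (simp add: C_def)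
  then show "(\<lambda>L. ln (C * real L) / real L) \<longlonglongrightarrow> 0" by real_asymp
  have "eventually (\<lambda>L. real (N L) / real L < \<bar>\<rho>\<bar> + 1) sequentially"
    by (rule order_tendstoD(2)[OF assms]) simp
  then show "eventually (\<lambda>L. ln (real (N L) + 1) / real L \<le> ln (C * real L) / real L) sequentially"
    using eventually_ge_at_top[of 1]
  proof eventually_elim
    case (elim L)
    then have "real (N L) < (\<bar>\<rho>\<bar> + 1) * real L" by (simp add: pos_divide_less_eq)
    also have "\<dots> = C * real L - real L" by (simp add: C_def algebra_simps)
    finally have "real (N L) + 1 \<le> C * real L" using elim by linarith
    then show ?case by (intro divide_right_mono ln_mono) auto
  qed
qed (auto intro!: always_eventually)

lemma thermodynamic_limit_perturbed_weight:
  assumes bulk: "bulk_weights w \<phi>bar"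
    and theta: "0 < \<theta>" and gamma: "0 < \<gamma>"
    and weights_pos: "\<And>L n. 1 \<le> L \<Longrightarrow> 0 < perturbed_weight w \<theta> \<gamma> \<kappa> \<delta> L n"
    and delta: "(\<lambda>L. real L * (SUP n\<in>{..N L}. \<bar>\<delta> L n\<bar>)) \<longlonglongrightarrow> 0"
    and rho: "0 \<le> \<rho>"
    and N_infinite: "filterlim N at_top sequentially"
    and density: "(\<lambda>L. real (N L) / real L) \<longlonglongrightarrow> \<rho>"
  shows "thermodynamic_limit w \<phi>bar (perturbed_weight w \<theta> \<gamma> \<kappa> \<delta>) N \<rho>
    (\<lambda>L. \<theta> / 2 / real L powr \<gamma> * (real (N L) + 1) powr (- \<bar>\<kappa>\<bar>))"
proof -
  interpret bulk_weights w \<phi>bar by (rule bulk)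
  let ?v = "perturbed_weight w \<theta> \<gamma> \<kappa> \<delta>"
  let ?lb = "\<lambda>L. \<theta> / 2 / real L powr \<gamma> * (real (N L) + 1) powr (- \<bar>\<kappa>\<bar>)"
  note half = eventually_delta_le_half[OF delta]
  have lower: "eventually (\<lambda>L. \<forall>n\<le>N L. w n \<le> ?v L n \<and> ?lb L \<le> ?v L n) sequentially"
    using half
  proof eventually_elim
    case (elim L)
    show ?case
    proof (intro allI impI)
      fix n assume n: "n \<le> N L"
      \<comment> \<open>The exponent \<open>- \<bar>\<kappa>\<bar>\<close> gives a bound uniform in
        \<open>n \<le> N L\<close> for either sign of \<open>\<kappa>\<close>.\<close>
      have "(real (N L) + 1) powr (- \<bar>\<kappa>\<bar>) \<le> (real n + 1) powr (- \<bar>\<kappa>\<bar>)"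
        using n by (intro powr_mono2') auto
      also have "\<dots> \<le> (real n + 1) powr \<kappa>" by (intro powr_mono) auto
      finally have "?lb L \<le> \<theta> / 2 / real L powr \<gamma> * (real n + 1) powr \<kappa>"
        using theta by (intro mult_left_mono) auto
      moreover have "0 \<le> ?lb L" using theta by simp
      moreover have "w n + \<theta> / 2 / real L powr \<gamma> * (real n + 1) powr \<kappa> \<le> ?v L n"
        using elim theta n by (intro perturbed_weight_bounds(1)[where M = "N L"]) auto
      ultimately show "w n \<le> ?v L n \<and> ?lb L \<le> ?v L n" using w_nonneg[of n] by linarith
    qed
  qed
  have small: "(\<lambda>L. 3 * \<theta> / 2 / real L powr \<gamma> * c) \<longlonglongrightarrow> 0" for c
    using gamma by real_asymp
  show ?thesis
  proof unfold_locales
    show "eventually (\<lambda>L. \<forall>n\<le>N L. w n \<le> ?v L n) sequentially"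
      using lower by eventually_elim blast
    show "eventually (\<lambda>L. \<forall>n\<le>N L. ?lb L \<le> ?v L n) sequentially"
      using lower by eventually_elim blast
    show "eventually (\<lambda>L. 0 < ?lb L) sequentially"
      using eventually_ge_at_top[of 1] by eventually_elim (use theta in auto)
    \<comment> \<open>The bound \<open>?lb L\<close> decays only polynomially in \<open>L\<close>
      and \<open>N L\<close>, so its logarithm is negligible per site.\<close>
    have "(\<lambda>L. ln (\<theta> / 2) / real L - \<gamma> * (ln (real L) / real L) - \<bar>\<kappa>\<bar> * (ln (real (N L) + 1) / real L))
        \<longlonglongrightarrow> 0 - \<gamma> * 0 - \<bar>\<kappa>\<bar> * 0"
    proof (intro tendsto_diff tendsto_mult_left ln_Suc_over_tendsto_0[OF density])
      show "(\<lambda>L. ln (\<theta> / 2) / real L) \<longlonglongrightarrow> 0" by real_asymp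
      show "(\<lambda>L. ln (real L) / real L) \<longlonglongrightarrow> 0" by real_asymp
    qed
    moreover have "eventually (\<lambda>L. ln (\<theta> / 2) / real L - \<gamma> * (ln (real L) / real L) - \<bar>\<kappa>\<bar> * (ln (real (N L) + 1) / real L)
        = ln (?lb L) / real L) sequentially"
      using eventually_ge_at_top[of 1]
    proof eventually_elim
      case (elim L)
      then have "ln (?lb L) = ln (\<theta> / 2) - \<gamma> * ln (real L) - \<bar>\<kappa>\<bar> * ln (real (N L) + 1)"
        using theta by (simp add: ln_mult ln_div ln_powr)
      then show ?case by (simp add: diff_divide_distrib)
    qed
    ultimately show "(\<lambda>L. ln (?lb L) / real L) \<longlonglongrightarrow> 0"
      by (auto intro: Lim_transform_eventually)
    show "(\<lambda>L. ?v L n) \<longlonglongrightarrow> w n" for n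
    proof (rule tendsto_sandwich[OF _ _ tendsto_const])
      have n: "eventually (\<lambda>L. n \<le> N L) sequentially" using N_infinite by (simp add: filterlim_at_top)
      show "eventually (\<lambda>L. w n \<le> ?v L n) sequentially"
        using lower n by eventually_elim blast
      show "eventually (\<lambda>L. ?v L n \<le> w n + 3 * \<theta> / 2 / real L powr \<gamma> * (real n + 1) powr \<kappa>) sequentially"
        using half n
      proof eventually_elim
        case (elim L)
        then show ?case using theta by (intro perturbed_weight_bounds(2)[where M = "N L"]) auto
      qed
      show "(\<lambda>L. w n + 3 * \<theta> / 2 / real L powr \<gamma> * (real n + 1) powr \<kappa>) \<longlonglongrightarrow> w n"
        using tendsto_add[OF tendsto_const small[of "(real n + 1) powr \<kappa>"], of "w n"] by simp
    qed
    fix \<phi> \<epsilon> :: real assume \<phi>: "0 < \<phi>" "\<phi> < 1" and \<epsilon>: "0 < \<epsilon>"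
    \<comment> \<open>For \<open>\<phi> < 1\<close> the geometric factor makes this series converge
      for every power \<open>\<kappa>\<close>, so the whole perturbation is a constant times a
      vanishing prefactor.\<close>
    let ?C = "\<Sum>n. (real n + 1) powr \<kappa> * \<phi> ^ n"
    have "eventually (\<lambda>L. 3 * \<theta> / 2 / real L powr \<gamma> * ?C < \<epsilon>) sequentially"
      by (rule order_tendstoD(2)[OF small \<epsilon>])
    then show "eventually (\<lambda>L. (\<Sum>j\<le>N L. ?v L j * \<phi> ^ j) \<le> bulk_z w \<phi> + \<epsilon>) sequentially"
      using half
    proof eventually_elim
      case (elim L)
      let ?a = "3 * \<theta> / 2 / real L powr \<gamma>"
      have "(\<Sum>j\<le>N L. ?v L j * \<phi> ^ j) \<le> (\<Sum>j\<le>N L. (w j + ?a * (real j + 1) powr \<kappa>) * \<phi> ^ j)"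
        using elim theta \<phi>
        by (intro sum_mono mult_right_mono perturbed_weight_bounds(2)[where M = "N L"]) auto
      also have "\<dots> = (\<Sum>j\<le>N L. w j * \<phi> ^ j) + ?a * (\<Sum>j\<le>N L. (real j + 1) powr \<kappa> * \<phi> ^ j)"
        by (simp add: distrib_right sum.distrib sum_distrib_left mult.assoc)
      also have "\<dots> \<le> bulk_z w \<phi> + ?a * ?C"
      proof (intro add_mono mult_left_mono)
        show "(\<Sum>j\<le>N L. w j * \<phi> ^ j) \<le> bulk_z w \<phi>"
          unfolding bulk_z_def using \<phi> w_nonneg
          by (intro sum_le_suminf summable_bulk le_1_less_phibar) auto
        show "(\<Sum>j\<le>N L. (real j + 1) powr \<kappa> * \<phi> ^ j) \<le> ?C"
          using \<phi> by (intro sum_le_suminf summable_powr_times_power) auto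
      qed (use theta in auto)
      finally show ?case using elim(1) by linarith
    qed
  qed (use rho weights_pos density N_infinite in auto)
qed

theorem theorem1:
  fixes \<Lambda> :: "nat \<Rightarrow> 'a set" and \<Delta> :: "'a set"
    and w :: "nat \<Rightarrow> real" and \<phi>bar :: ereal
    and \<theta> \<gamma> \<kappa> \<rho> :: real and \<delta> :: "nat \<Rightarrow> nat \<Rightarrow> real"
    and N :: "nat \<Rightarrow> nat"
  assumes sites: "\<And>L. finite (\<Lambda> L)" "\<And>L. card (\<Lambda> L) = L"
    and bulk_nonneg: "\<And>n. 0 \<le> w n"
    and phibar: "1 < \<phi>bar"
    and bulk_radius: "\<And>\<phi>. 0 \<le> \<phi> \<Longrightarrow> summable (\<lambda>n. w n * \<phi> ^ n) \<longleftrightarrow> ereal \<phi> < \<phi>bar"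
    and bulk_normalized: "w sums 1"
    and crit_finite: "summable (\<lambda>n. real n * w n)"
    and R_onto: "\<And>r. 0 \<le> r \<Longrightarrow> \<exists>\<phi>\<ge>0. ereal \<phi> < \<phi>bar \<and> bulk_R w \<phi> = r"
    and theta: "0 < \<theta>" and gamma: "0 < \<gamma>" and kappa: "-1 < \<kappa>"
    and weights_pos: "\<And>L n. 1 \<le> L \<Longrightarrow> 0 < perturbed_weight w \<theta> \<gamma> \<kappa> \<delta> L n"
    and delta: "(\<lambda>L. real L * (SUP n\<in>{..N L}. \<bar>\<delta> L n\<bar>)) \<longlonglongrightarrow> 0"
    and rho: "0 \<le> \<rho>"
    and N_infinite: "filterlim N at_top sequentially"
    and density: "(\<lambda>L. real (N L) / real L) \<longlonglongrightarrow> \<rho>"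
    and fixed_sites: "finite \<Delta>" "eventually (\<lambda>L. \<Delta> \<subseteq> \<Lambda> L) sequentially"
  shows "converges_in_distribution (config_topology \<Delta>)
           (\<lambda>L. marginal \<Delta> (canonical_measure (perturbed_weight w \<theta> \<gamma> \<kappa> \<delta> L) (\<Lambda> L) (N L)))
           (bulk_measure w (bulk_Phi w \<phi>bar \<rho>) \<Delta>)"
proof -
  have "bulk_weights w \<phi>bar"
    using bulk_nonneg phibar bulk_radius bulk_normalized R_onto by unfold_locales
  then interpret thermodynamic_limit w \<phi>bar "perturbed_weight w \<theta> \<gamma> \<kappa> \<delta>" N \<rho>
      "\<lambda>L. \<theta> / 2 / real L powr \<gamma> * (real (N L) + 1) powr (- \<bar>\<kappa>\<bar>)"
    using theta gamma weights_pos delta rho N_infinite density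
    by (rule thermodynamic_limit_perturbed_weight)
  show ?thesis using sites fixed_sites by (rule marginals_converge)
qed

end
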